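(* Assume GCH. Let $0\le m<n^*<\omega$ and let $E\subseteq\omega\setminus(n^*+1)$ be such that for all $i\in E$, $i+1\notin E$. Let $\langle n_i : i\in E\rangle$ be natural numbers with each $n_i<n^*$. Suppose that for each $i\in E$ there is an $\aleph_i$-complete filter $F_i$ on $\aleph_i$ containing all closed unbounded subsets of $\aleph_i$ such that $W_i=\{\alpha<\aleph_i : \mathrm{cf}(\alpha)=\aleph_{n_i}\}\in F_i^+$ and the second player has a winning strategy in the game $GM'_{\aleph_m,\aleph_i}(F_i)$. Let $f$ be the function on $\{i<\omega: i>n^*\}$ defined by $f(i)=n_i$ if $i\in E$ and $f(i)=m$ if $n^*<i\notin E$. Then the set $$S'=\{x\subseteq\aleph_\omega : |x|\le\aleph_{n^*} \text{ and } \forall i>n^*\ [\mathrm{cf}(x\cap\aleph_i)=\aleph_{f(i)}]\}$$ is stationary in $[\aleph_\omega]^{<\aleph_{n^*+1}}$.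
   Context: For a filter $D$ on $\kappa$, $D^+$ is the set of $Y\subseteq\kappa$ whose complement is not in $D$ (written $Y\neq\emptyset\bmod D$). For cardinals $\lambda<\kappa$ and a $\kappa$-complete filter $D$ on $\kappa$, the cut-and-choose game $GM'_{\lambda,\kappa}(D)$ of length $\lambda$ is played as follows: at move $0$ the first player chooses a set $A_0\in D^+$ and partitions $A_0$ into fewer than $\kappa$ parts, and the second player chooses one of the parts $B_0\in D^+$; at move $\xi>0$ the first player partitions $\bigcap_{\eta<\xi}B_\eta$ into fewer than $\kappa$ parts and the second player chooses one of the parts $B_\xi\in D^+$. A player without a legal move loses immediately; if the game lasts $\lambda$ moves, the second player wins iff $\bigcap_{\xi<\lambda}B_\xi$ is unbounded in $\kappa$. A subset of $[\aleph_\omega]^{<\aleph_{n^*+1}}$ is stationary if it meets every closed unbounded subset of $[\aleph_\omega]^{<\aleph_{n^*+1}}$. *)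

theory Defs
  imports Main "HOL-Library.FuncSet" "HOL-Library.Disjoint_Sets"
begin

unbundle cardinal_syntax

text \<open>
  Ordinals are represented by the elements of a type \<open>'a\<close> of class \<^class>\<open>wellorder\<close>: the element
  \<open>\<alpha>\<close> stands for the order type of \<open>{..<\<alpha>}\<close>, and, as in von Neumann's representation, the set of
  ordinals \<open>{..<\<alpha>}\<close> plays the role of \<open>\<alpha>\<close> itself. A cardinal is an initial ordinal, and
  \<open>|X| <o |{..<\<kappa>}|\<close> says that \<open>X\<close> has fewer than \<open>\<kappa>\<close> elements.
\<close>

definition gch :: "'a itself \<Rightarrow> bool" where
  "gch _ \<longleftrightarrow> (\<forall>X :: 'a set. infinite X \<longrightarrow> |Pow X| =o cardSuc |X| )"


subsection \<open>The cardinals \<open>\<aleph>\<^sub>n\<close> and \<open>\<aleph>\<^sub>\<omega>\<close>\<close>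

primrec is_aleph :: "nat \<Rightarrow> 'a::wellorder \<Rightarrow> bool" where
  "is_aleph 0 \<alpha> \<longleftrightarrow> infinite {..<\<alpha>} \<and> (\<forall>\<beta><\<alpha>. finite {..<\<beta>})"
| "is_aleph (Suc n) \<alpha> \<longleftrightarrow>
     (\<exists>\<gamma>. is_aleph n \<gamma> \<and> |{..<\<gamma>}| <o |{..<\<alpha>}| \<and> (\<forall>\<beta><\<alpha>. |{..<\<beta>}| \<le>o |{..<\<gamma>}| ))"

definition aleph :: "nat \<Rightarrow> 'a::wellorder" where
  "aleph n = (THE \<alpha>. is_aleph n \<alpha>)"

definition aleph_omega :: "'a::wellorder" where
  "aleph_omega = (LEAST \<alpha>. \<forall>n. aleph n < \<alpha>)"

text \<open>
  \<^const>\<open>aleph\<close> and \<^const>\<open>aleph_omega\<close> have their intended values only if \<open>'a\<close> is long enough.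
  HOL, unlike ZFC, does not prove that there is a type with this property.
\<close>

definition has_aleph_omega :: "'a::wellorder itself \<Rightarrow> bool" where
  "has_aleph_omega _ \<longleftrightarrow> (\<exists>\<alpha>::'a. \<forall>n. \<exists>\<beta><\<alpha>. is_aleph n \<beta>)"


subsection \<open>Cofinality, closed unbounded subsets of an ordinal\<close>

text \<open>
  The cofinality of (the order type of) a set of ordinals; \<open>cf {..<\<alpha>}\<close> is the cofinality of \<open>\<alpha>\<close>.
\<close>

definition cf :: "'a::wellorder set \<Rightarrow> 'a" where
  "cf X = (LEAST \<mu>. \<exists>A\<subseteq>X. (\<forall>x\<in>X. \<exists>a\<in>A. x \<le> a) \<and> |A| =o |{..<\<mu>}| )"

definition unbounded_in :: "'a::wellorder \<Rightarrow> 'a set \<Rightarrow> bool" where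
  "unbounded_in \<delta> X \<longleftrightarrow> (\<forall>\<alpha><\<delta>. \<exists>\<beta>\<in>X. \<alpha> < \<beta> \<and> \<beta> < \<delta>)"

text \<open>
  No set is unbounded in a successor ordinal in the sense of \<^const>\<open>unbounded_in\<close>, so the nonzero
  \<open>\<delta>\<close> considered in the closure condition are automatically limit ordinals.
\<close>

definition club_in :: "'a::wellorder \<Rightarrow> 'a set \<Rightarrow> bool" where
  "club_in \<kappa> C \<longleftrightarrow>
     C \<subseteq> {..<\<kappa>} \<and> unbounded_in \<kappa> C \<and>
     (\<forall>\<delta><\<kappa>. {..<\<delta>} \<noteq> {} \<and> unbounded_in \<delta> C \<longrightarrow> \<delta> \<in> C)"


subsection \<open>Filters on a cardinal\<close>

text \<open>
  A filter \<open>D\<close> on \<open>\<kappa>\<close> is represented by the library filter on \<open>'a\<close> it generates, so that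
  \<open>Y \<in> D\<close> reads \<open>eventually (\<lambda>\<alpha>. \<alpha> \<in> Y) D\<close>.
\<close>

definition in_filter :: "'a set \<Rightarrow> 'a filter \<Rightarrow> bool" where
  "in_filter Y D \<longleftrightarrow> eventually (\<lambda>\<alpha>. \<alpha> \<in> Y) D"

definition filter_on :: "'a::wellorder \<Rightarrow> 'a filter \<Rightarrow> bool" where
  "filter_on \<kappa> D \<longleftrightarrow> D \<noteq> bot \<and> in_filter {..<\<kappa>} D"

definition complete_filter :: "'a::wellorder \<Rightarrow> 'a filter \<Rightarrow> bool" where
  "complete_filter \<kappa> D \<longleftrightarrow>
     (\<forall>\<Y>. \<Y> \<noteq> {} \<and> |\<Y>| <o |{..<\<kappa>}| \<and> (\<forall>Y\<in>\<Y>. in_filter Y D) \<longrightarrow> in_filter (\<Inter>\<Y>) D)"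

definition positive_sets :: "'a::wellorder \<Rightarrow> 'a filter \<Rightarrow> 'a set set" where
  "positive_sets \<kappa> D = {Y. Y \<subseteq> {..<\<kappa>} \<and> \<not> in_filter ({..<\<kappa>} - Y) D}"


subsection \<open>The game \<open>GM'\<close>\<close>

text \<open>
  A play is given by the partitions \<open>P \<xi>\<close> of the first player and the choices \<open>B \<xi>\<close> of the
  second player. The set \<open>A\<^sub>0\<close> chosen at move \<open>0\<close> is \<open>\<Union>(P 0)\<close>. The parts of a partition are
  nonempty, and the empty set has the empty partition.
\<close>

definition first_legal ::
  "'a::wellorder \<Rightarrow> 'a filter \<Rightarrow> ('a \<Rightarrow> 'a set set) \<Rightarrow> ('a \<Rightarrow> 'a set) \<Rightarrow> 'a \<Rightarrow> bool" where
  "first_legal \<kappa> D P B \<xi> \<longleftrightarrow>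
     |P \<xi>| <o |{..<\<kappa>}| \<and>
     (if {..<\<xi>} = {} then \<exists>A\<^sub>0 \<in> positive_sets \<kappa> D. partition_on A\<^sub>0 (P \<xi>)
      else partition_on (\<Inter>\<eta>\<in>{..<\<xi>}. B \<eta>) (P \<xi>))"

definition second_legal ::
  "'a::wellorder \<Rightarrow> 'a filter \<Rightarrow> ('a \<Rightarrow> 'a set set) \<Rightarrow> ('a \<Rightarrow> 'a set) \<Rightarrow> 'a \<Rightarrow> bool" where
  "second_legal \<kappa> D P B \<xi> \<longleftrightarrow> B \<xi> \<in> P \<xi> \<and> B \<xi> \<in> positive_sets \<kappa> D"

text \<open>
  A strategy of the second player computes the choice at move \<open>\<xi>\<close> from \<open>\<xi>\<close>, from the moves
  \<open>P \<eta>\<close> with \<open>\<eta> \<le> \<xi>\<close>, and from the moves \<open>B \<eta>\<close> with \<open>\<eta> < \<xi>\<close>.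
\<close>

type_synonym 'a strategy = "'a \<Rightarrow> ('a \<Rightarrow> 'a set set) \<Rightarrow> ('a \<Rightarrow> 'a set) \<Rightarrow> 'a set"

definition follows ::
  "'a::wellorder strategy \<Rightarrow> ('a \<Rightarrow> 'a set set) \<Rightarrow> ('a \<Rightarrow> 'a set) \<Rightarrow> 'a \<Rightarrow> bool" where
  "follows \<sigma> P B \<xi> \<longleftrightarrow> B \<xi> = \<sigma> \<xi> (restrict P {..\<xi>}) (restrict B {..<\<xi>})"

text \<open>
  The first conjunct says that the second player, following \<open>\<sigma>\<close>, never makes an illegal move as
  long as the first player moves legally (in particular is never without a legal move); the second
  conjunct concerns the plays which last \<open>\<lambda>\<close> moves (written \<open>\<theta>\<close> here). Plays in which the first
  player gets stuck are won by the second player and impose no further condition.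
\<close>

definition winning_strategy ::
  "'a::wellorder \<Rightarrow> 'a \<Rightarrow> 'a filter \<Rightarrow> 'a strategy \<Rightarrow> bool" where
  "winning_strategy \<theta> \<kappa> D \<sigma> \<longleftrightarrow>
     (\<forall>P B.
        (\<forall>\<xi><\<theta>. (\<forall>\<eta>\<le>\<xi>. first_legal \<kappa> D P B \<eta> \<and> follows \<sigma> P B \<eta>) \<longrightarrow> second_legal \<kappa> D P B \<xi>) \<and>
        ((\<forall>\<xi><\<theta>. first_legal \<kappa> D P B \<xi> \<and> follows \<sigma> P B \<xi>) \<longrightarrow>
           unbounded_in \<kappa> (\<Inter>\<xi>\<in>{..<\<theta>}. B \<xi>)))"

definition second_wins_GM' :: "'a::wellorder \<Rightarrow> 'a \<Rightarrow> 'a filter \<Rightarrow> bool" where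
  "second_wins_GM' \<theta> \<kappa> D \<longleftrightarrow> (\<exists>\<sigma>. winning_strategy \<theta> \<kappa> D \<sigma>)"


subsection \<open>Stationary subsets of \<open>[A]\<^bsup><\<mu>\<^esup>\<close>\<close>

definition subsets_below :: "'a set \<Rightarrow> 'a::wellorder \<Rightarrow> 'a set set" where
  "subsets_below A \<mu> = {x. x \<subseteq> A \<and> |x| <o |{..<\<mu>}| }"

text \<open>
  Closure under unions of \<open>\<subseteq>\<close>-chains with fewer than \<open>\<mu>\<close> members is the same as closure under
  unions of \<open>\<subseteq>\<close>-increasing sequences of length less than \<open>\<mu>\<close>, as every chain has a well-ordered
  cofinal subchain.
\<close>

definition club_in_subsets :: "'a set \<Rightarrow> 'a::wellorder \<Rightarrow> 'a set set \<Rightarrow> bool" where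
  "club_in_subsets A \<mu> C \<longleftrightarrow>
     C \<subseteq> subsets_below A \<mu> \<and>
     (\<forall>x\<in>subsets_below A \<mu>. \<exists>y\<in>C. x \<subseteq> y) \<and>
     (\<forall>\<X>\<subseteq>C. \<X> \<noteq> {} \<and> chain\<^sub>\<subseteq> \<X> \<and> |\<X>| <o |{..<\<mu>}| \<longrightarrow> \<Union>\<X> \<in> C)"

definition stationary_in_subsets :: "'a set \<Rightarrow> 'a::wellorder \<Rightarrow> 'a set set \<Rightarrow> bool" where
  "stationary_in_subsets A \<mu> S \<longleftrightarrow>
     S \<subseteq> subsets_below A \<mu> \<and> (\<forall>C. club_in_subsets A \<mu> C \<longrightarrow> S \<inter> C \<noteq> {})"

end

theory Submission
  imports Defs
begin

text \<open>
  Every club of \<open>[\<aleph>\<^sub>\<omega>]\<^bsup><\<aleph>\<^bsub>n*+1\<^esub>\<^esup>\<close> contains all small sets closed under some function from finite sets to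
  sets of size \<open>\<aleph>\<^bsub>n*\<^esub>\<close>. A closed set with the required cofinalities is generated by \<open>\<omega>\<^bsub>n*\<^esub>\<close>, by cofinal
  subsets of ordinals \<open>\<delta>\<^sub>i \<in> W\<^sub>i\<close> for \<open>i \<in> E\<close>, and by increasing sequences of length \<open>\<omega>\<^sub>m\<close> in the
  remaining \<open>\<aleph>\<^sub>j\<close>. The \<open>\<delta>\<^sub>i\<close> are not chosen until all the games have been played simultaneously, with
  the second player following the winning strategies. At move \<open>\<xi>\<close> the supremum in \<open>\<aleph>\<^sub>j\<close> of the hull of
  the generators obtained so far, with finitely many \<open>\<delta>\<^sub>i\<close> as parameters, is made independent of the
  \<open>\<delta>\<^sub>i\<close> with \<open>i > j\<close>, by partitioning the positive set at hand according to its values, for the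
  largest \<open>i\<close> first. As \<open>i - 1 \<notin> E\<close>, the other parameters range over at most \<open>\<aleph>\<^bsub>i-2\<^esub>\<close> values, so GCH
  bounds the number of parts by \<open>\<aleph>\<^bsub>i-1\<^esub>\<close>. For \<open>j \<notin> E\<close> the resulting supremum becomes the next term
  of the sequence in \<open>\<aleph>\<^sub>j\<close>; for \<open>j \<in> E\<close> it is a function on \<open>\<aleph>\<^sub>j\<close>, and the second player is forced
  into the club of its closure points, which keeps the hull intersected with \<open>\<aleph>\<^sub>j\<close> below \<open>\<delta>\<^sub>j\<close>.
\<close>

subsection \<open>Cardinal arithmetic\<close>

text \<open>The order of the type well-orders \<open>{..<\<alpha>}\<close>, so \<open>|A|\<close>
  lies strictly below it and is isomorphic to a proper initial segment. This translates library
  cardinals into ordinals of the type.\<close>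

lemma card_of_ordLess_lessThan:
  fixes \<alpha> :: "'a::wellorder"
  assumes "|A| <o |{..<\<alpha>}|"
  obtains \<beta> where "\<beta> < \<alpha>" "|A| =o |{..<\<beta>}|"
proof -
  define r where "r = {(x, y). x \<le> y \<and> y < \<alpha>}"
  have F: "Field r = {..<\<alpha>}"
    by (auto simp: r_def Field_def)
  have wf: "wf (r - Id)"
    by (rule wf_subset[OF wf]) (auto simp: r_def)
  have "well_order_on {..<\<alpha>} r"
    unfolding well_order_on_def linear_order_on_def partial_order_on_def preorder_on_def
      refl_on_def trans_def antisym_def total_on_def
    using wf by (auto simp: r_def)
  then have "|{..<\<alpha>}| \<le>o r" and W: "Well_order r"
    using card_of_least F by auto
  with assms have "|A| <o r"
    using ordLess_ordLeq_trans by blast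
  then obtain \<beta> where \<beta>: "\<beta> \<in> Field r" "|A| =o Restr r (underS r \<beta>)"
    using ordLess_iff_ordIso_Restr[OF W card_of_Well_order] by blast
  have "Field (Restr r (underS r \<beta>)) = {..<\<beta>}"
    using \<beta>(1) by (auto simp: F) (auto simp: r_def underS_def Field_def)
  then have "|A| =o |{..<\<beta>}|"
    using card_of_cong[OF \<beta>(2)] by (simp add: Field_card_of)
  with \<beta>(1) F that show ?thesis by blast
qed

lemma card_of_ordLeq_lessThan:
  fixes \<alpha> :: "'a::wellorder"
  assumes "|A| \<le>o |{..<\<alpha>}|"
  obtains \<beta> where "\<beta> \<le> \<alpha>" "|A| =o |{..<\<beta>}|"
  using assms card_of_ordLess_lessThan[of A \<alpha>] unfolding ordLeq_iff_ordLess_or_ordIso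
  by (metis order.order_iff_strict)

lemma card_of_UN_le:
  assumes "infinite L" "|I| \<le>o |L|" "\<And>i. i \<in> I \<Longrightarrow> |A i| \<le>o |L|"
  shows "|\<Union>i\<in>I. A i| \<le>o |L|"
  using card_of_UNION_ordLeq_infinite[OF assms(1,2)] assms(3) by blast

lemma card_of_Un_le:
  assumes "infinite L" "|A| \<le>o |L|" "|B| \<le>o |L|"
  shows "|A \<union> B| \<le>o |L|"
  using card_of_Un_ordLeq_infinite_Field[of "|L|" A B] assms by (metis Field_card_of card_of_Card_order)

lemma card_of_Times_le:
  assumes "infinite L" "|A| \<le>o |L|" "|B| \<le>o |L|"
  shows "|A \<times> B| \<le>o |L|"
  using card_of_Times_ordLeq_infinite_Field[of "|L|" A B] assms by (metis Field_card_of card_of_Card_order)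

lemma card_of_image_le: "|A| \<le>o |L| \<Longrightarrow> |f ` A| \<le>o |L|"
  using card_of_image ordLeq_transitive by blast

lemma card_of_subset_le: "A \<subseteq> B \<Longrightarrow> |B| \<le>o |L| \<Longrightarrow> |A| \<le>o |L|"
  using card_of_mono1 ordLeq_transitive by blast

lemma card_of_finite_le:
  assumes "infinite L" "finite A" shows "|A| \<le>o |L|"
  using assms ordLeq_iff_ordLess_or_ordIso card_of_ordLeq_finite
  by (metis card_of_Well_order not_ordLeq_iff_ordLess ordLess_imp_ordLeq)

lemma card_of_nat_le:
  fixes A :: "nat set"
  assumes "infinite L" shows "|A| \<le>o |L|"
  using assms infinite_iff_card_of_nat card_of_subset_le subset_UNIV by metis

lemma card_of_PiE_le:
  assumes "infinite L" "finite I" "\<And>i. i \<in> I \<Longrightarrow> |F i| \<le>o |L|"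
  shows "|Pi\<^sub>E I F| \<le>o |L|"
  using assms(2,3)
proof (induction I rule: finite_induct)
  case empty
  then show ?case by (auto intro!: card_of_finite_le[OF assms(1)])
next
  case (insert i I)
  then show ?case
    unfolding PiE_insert_eq
    by (intro card_of_image_le card_of_Times_le assms(1)) auto
qed

lemma card_of_finite_subsets_le:
  assumes "infinite L" "|A| \<le>o |L|"
  shows "|{s. finite s \<and> s \<subseteq> A}| \<le>o |L|"
proof -
  define S where "S k = {s. finite s \<and> s \<subseteq> A \<and> card s = k}" for k
  have "|S k| \<le>o |L|" for k
  proof (induction k)
    case 0
    have "S 0 \<subseteq> {{}}" by (auto simp: S_def)
    then show ?case using card_of_finite_le[OF assms(1)] finite_subset by blast
  next
    case (Suc k)
    have "S (Suc k) \<subseteq> (\<lambda>(x, s). insert x s) ` (A \<times> S k)"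
    proof
      fix s assume s: "s \<in> S (Suc k)"
      then obtain x where "x \<in> s" by (fastforce simp: S_def)
      with s have "(x, s - {x}) \<in> A \<times> S k" "s = insert x (s - {x})"
        by (auto simp: S_def)
      then show "s \<in> (\<lambda>(x, s). insert x s) ` (A \<times> S k)"
        by (metis (mono_tags, lifting) case_prod_conv image_eqI)
    qed
    then show ?case
      by (rule card_of_subset_le) (intro card_of_image_le card_of_Times_le assms Suc)
  qed
  then have "|\<Union>k\<in>(UNIV :: nat set). S k| \<le>o |L|"
    using card_of_UN_le[OF assms(1) card_of_nat_le[OF assms(1)]] by blast
  moreover have "(\<Union>k\<in>(UNIV :: nat set). S k) = {s. finite s \<and> s \<subseteq> A}"
    by (auto simp: S_def)
  ultimately show ?thesis by simp
qed

text \<open>An injection of \<theta> \<times> nat into \<theta> splits \<theta> into countably many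
  columns of full size. No bound below \<theta> can contain a column, since proper initial segments
  are smaller.\<close>

lemma cofinal_fibres:
  fixes \<theta> :: "'a::wellorder"
  assumes "infinite {..<\<theta>}" and init: "\<And>\<beta>. \<beta> < \<theta> \<Longrightarrow> |{..<\<beta>}| <o |{..<\<theta>}|"
  obtains h :: "'a \<Rightarrow> nat" where "\<And>k \<xi>. \<xi> < \<theta> \<Longrightarrow> \<exists>\<xi>'. \<xi> \<le> \<xi>' \<and> \<xi>' < \<theta> \<and> h \<xi>' = k"
proof -
  have "|{..<\<theta>} \<times> (UNIV :: nat set)| \<le>o |{..<\<theta>}|"
    by (intro card_of_Times_le card_of_nat_le assms(1)) (auto simp: card_of_mono1)
  then obtain p where p: "inj_on p ({..<\<theta>} \<times> (UNIV :: nat set))" "p ` ({..<\<theta>} \<times> UNIV) \<subseteq> {..<\<theta>}"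
    using card_of_ordLeq by metis
  define h where "h x = snd (inv_into ({..<\<theta>} \<times> (UNIV :: nat set)) p x)" for x
  show ?thesis
  proof (rule that[of h])
    fix k \<xi> assume \<xi>: "\<xi> < \<theta>"
    define Q where "Q = (\<lambda>x. p (x, k)) ` {..<\<theta>}"
    have inj: "inj_on (\<lambda>x. p (x, k)) {..<\<theta>}"
      using p(1) by (auto simp: inj_on_def)
    have "\<not> Q \<subseteq> {..<\<xi>}"
    proof
      assume "Q \<subseteq> {..<\<xi>}"
      with inj have "|{..<\<theta>}| \<le>o |{..<\<xi>}|"
        unfolding Q_def card_of_ordLeq[symmetric] by blast
      then show False using init[OF \<xi>] not_ordLess_ordLeq by blast
    qed
    then obtain x where x: "x < \<theta>" "\<not> p (x, k) < \<xi>" unfolding Q_def by auto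
    have "h (p (x, k)) = k"
      unfolding h_def using x inv_into_f_f[OF p(1), of "(x, k)"] by auto
    then show "\<exists>\<xi>'. \<xi> \<le> \<xi>' \<and> \<xi>' < \<theta> \<and> h \<xi>' = k"
      using x p(2) by (intro exI[of _ "p (x, k)"]) auto
  qed
qed

subsection \<open>Cofinality\<close>

lemma cf_le:
  fixes X :: "'a::wellorder set"
  assumes "A \<subseteq> X" "\<forall>x\<in>X. \<exists>a\<in>A. x \<le> a" "|A| \<le>o |{..<\<mu>}|"
  shows "cf X \<le> \<mu>"
proof -
  obtain \<nu> where "\<nu> \<le> \<mu>" "|A| =o |{..<\<nu>}|"
    using card_of_ordLeq_lessThan[OF assms(3)] .
  moreover have "cf X \<le> \<nu>"
    unfolding cf_def using assms(1,2) \<open>|A| =o |{..<\<nu>}|\<close> by (intro Least_le) blast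
  ultimately show ?thesis by simp
qed

text \<open>The size hypothesis makes the \<open>LEAST\<close> in \<open>cf\<close> range over a
  nonempty class: some ordinal of the type is equinumerous with \<open>X\<close>.\<close>

lemma cf_witness:
  fixes X :: "'a::wellorder set" and \<mu> :: 'a
  assumes "|X| \<le>o |{..<\<mu>}|"
  obtains A where "A \<subseteq> X" "\<forall>x\<in>X. \<exists>a\<in>A. x \<le> a" "|A| =o |{..<cf X}|"
proof -
  obtain \<nu> :: 'a where "|X| =o |{..<\<nu>}|"
    using card_of_ordLeq_lessThan[OF assms] by metis
  then have "\<exists>\<mu> :: 'a. \<exists>A\<subseteq>X. (\<forall>x\<in>X. \<exists>a\<in>A. x \<le> a) \<and> |A| =o |{..<\<mu>}|"
    by (intro exI[of _ \<nu>] exI[of _ X]) auto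
  then have "\<exists>A\<subseteq>X. (\<forall>x\<in>X. \<exists>a\<in>A. x \<le> a) \<and> |A| =o |{..<cf X}|"
    unfolding cf_def by (rule LeastI_ex)
  then show ?thesis using that by blast
qed

text \<open>Cofinal subsets of \<open>Y\<close> are cofinal in \<open>X\<close>; conversely, moving
  the elements of a cofinal subset of \<open>X\<close> up into \<open>Y\<close> does not increase
  its size.\<close>

lemma cf_cofinal_subset:
  fixes X :: "'a::wellorder set" and \<mu> :: 'a
  assumes "Y \<subseteq> X" "\<forall>x\<in>X. \<exists>y\<in>Y. x \<le> y" "|X| \<le>o |{..<\<mu>}|"
  shows "cf X = cf Y"
proof (rule antisym)
  have "|Y| \<le>o |{..<\<mu>}|" using assms card_of_subset_le by blast
  then obtain A where A: "A \<subseteq> Y" "\<forall>x\<in>Y. \<exists>a\<in>A. x \<le> a" "|A| =o |{..<cf Y}|"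
    using cf_witness by metis
  have "\<exists>a\<in>A. x \<le> a" if "x \<in> X" for x
    using that assms(2) A(2) by (meson order_trans)
  then show "cf X \<le> cf Y"
    using A assms(1) by (intro cf_le[of A]) (auto simp: ordIso_imp_ordLeq)
  obtain A where A: "A \<subseteq> X" "\<forall>x\<in>X. \<exists>a\<in>A. x \<le> a" "|A| =o |{..<cf X}|"
    using cf_witness[OF assms(3)] by metis
  obtain p where p: "\<And>x. x \<in> X \<Longrightarrow> p x \<in> Y \<and> x \<le> p x"
    using assms(2) by metis
  have "\<exists>a\<in>p ` A. y \<le> a" if y: "y \<in> Y" for y
  proof -
    obtain a where a: "a \<in> A" "y \<le> a" using y A(2) assms(1) by blast
    then have "y \<le> p a" using p A(1) order_trans by blast
    with a show ?thesis by blast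
  qed
  moreover have "p ` A \<subseteq> Y" using p A(1) by blast
  ultimately show "cf Y \<le> cf X"
    by (intro cf_le[of "p ` A"] card_of_image_le) (auto simp: ordIso_imp_ordLeq A(3))
qed

text \<open>Regularity in the form in which it is applied: small subsets are bounded.\<close>

definition regular :: "'a::wellorder \<Rightarrow> bool" where
  "regular \<kappa> \<longleftrightarrow> infinite {..<\<kappa>} \<and>
     (\<forall>X\<subseteq>{..<\<kappa>}. |X| <o |{..<\<kappa>}| \<longrightarrow> (\<exists>\<beta><\<kappa>. \<forall>x\<in>X. x < \<beta>))"

text \<open>A cofinal subset of the image with fewer than \<theta> elements would have a bounded set
  of indices, and the value at a bound of the indices would exceed all its elements.\<close>

lemma cf_strict_mono_image:
  fixes g :: "'a::wellorder \<Rightarrow> 'a"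
  assumes "regular \<theta>" and init: "\<And>\<beta>. \<beta> < \<theta> \<Longrightarrow> |{..<\<beta>}| <o |{..<\<theta>}|"
    and mono: "\<And>\<xi> \<eta>. \<eta> < \<xi> \<Longrightarrow> \<xi> < \<theta> \<Longrightarrow> g \<eta> < g \<xi>"
  shows "cf (g ` {..<\<theta>}) = \<theta>"
proof (rule antisym)
  have le: "|g ` {..<\<theta>}| \<le>o |{..<\<theta>}|" by (rule card_of_image)
  then show "cf (g ` {..<\<theta>}) \<le> \<theta>" by (intro cf_le[of "g ` {..<\<theta>}"]) auto
  obtain A where A: "A \<subseteq> g ` {..<\<theta>}" "\<forall>x\<in>g ` {..<\<theta>}. \<exists>a\<in>A. x \<le> a"
    "|A| =o |{..<cf (g ` {..<\<theta>})}|"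
    using cf_witness[OF le] by metis
  show "\<theta> \<le> cf (g ` {..<\<theta>})"
  proof (rule ccontr)
    assume "\<not> \<theta> \<le> cf (g ` {..<\<theta>})"
    then have less: "|A| <o |{..<\<theta>}|"
      using init A(3) ordIso_ordLess_trans not_le_imp_less by blast
    have "\<forall>a\<in>A. \<exists>\<xi>. \<xi> < \<theta> \<and> g \<xi> = a" using A(1) by auto
    then obtain p where p: "\<And>a. a \<in> A \<Longrightarrow> p a < \<theta> \<and> g (p a) = a" by metis
    have "|p ` A| <o |{..<\<theta>}|" using less card_of_image ordLeq_ordLess_trans by blast
    moreover have "p ` A \<subseteq> {..<\<theta>}" using p by auto
    ultimately obtain \<beta> where \<beta>: "\<beta> < \<theta>" "\<forall>x\<in>p ` A. x < \<beta>"
      using assms(1) unfolding regular_def by blast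
    then obtain a where a: "a \<in> A" "g \<beta> \<le> a" using A(2) by blast
    then show False using p[OF a(1)] \<beta> mono[of "p a" \<beta>] by auto
  qed
qed

text \<open>Closure points above \<alpha> come from iterating a bound for \<open>g\<close> \<omega>
  times; the supremum stays below \<kappa> because \<kappa> is regular and uncountable.\<close>

lemma club_in_closure_points:
  fixes g :: "'a::wellorder \<Rightarrow> 'a"
  assumes "regular \<kappa>" and unc: "|UNIV :: nat set| <o |{..<\<kappa>}|"
    and init: "\<And>\<beta>. \<beta> < \<kappa> \<Longrightarrow> |{..<\<beta>}| <o |{..<\<kappa>}|"
    and g: "\<And>\<beta>. \<beta> < \<kappa> \<Longrightarrow> g \<beta> < \<kappa>"
  shows "club_in \<kappa> {\<delta>. \<delta> < \<kappa> \<and> (\<forall>\<beta><\<delta>. g \<beta> \<le> \<delta>)}"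
proof -
  let ?D = "{\<delta>. \<delta> < \<kappa> \<and> (\<forall>\<beta><\<delta>. g \<beta> \<le> \<delta>)}"
  have bdd: "\<exists>\<beta><\<kappa>. \<forall>x\<in>X. x < \<beta>" if "X \<subseteq> {..<\<kappa>}" "|X| <o |{..<\<kappa>}|" for X
    using assms(1) that unfolding regular_def by blast
  have "\<exists>\<beta>\<in>?D. \<alpha> < \<beta> \<and> \<beta> < \<kappa>" if \<alpha>: "\<alpha> < \<kappa>" for \<alpha>
  proof -
    have "\<exists>\<gamma><\<kappa>. \<beta> < \<gamma> \<and> (\<forall>\<beta>'<\<beta>. g \<beta>' < \<gamma>)" if \<beta>: "\<beta> < \<kappa>" for \<beta>
    proof -
      have "|{\<beta>}| <o |{..<\<kappa>}|"
        using assms(1) unfolding regular_def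
        by (intro finite_ordLess_infinite card_of_Well_order) (auto simp: Field_card_of)
      moreover have "|g ` {..<\<beta>}| <o |{..<\<kappa>}|"
        by (rule ordLeq_ordLess_trans[OF card_of_image init[OF \<beta>]])
      ultimately have "|insert \<beta> (g ` {..<\<beta>})| <o |{..<\<kappa>}|"
        using card_of_Un_ordLess_infinite[of "{..<\<kappa>}" "{\<beta>}" "g ` {..<\<beta>}"] assms(1)
        by (simp add: regular_def)
      from bdd[OF _ this] show ?thesis using \<beta> g by fastforce
    qed
    then obtain s where s: "\<And>\<beta>. \<beta> < \<kappa> \<Longrightarrow> s \<beta> < \<kappa> \<and> \<beta> < s \<beta> \<and> (\<forall>\<beta>'<\<beta>. g \<beta>' < s \<beta>)"
      by metis
    define a where "a k = (s ^^ k) \<alpha>" for k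
    have a: "a k < \<kappa>" for k by (induction k) (auto simp: a_def \<alpha> s)
    have a_Suc: "a k < a (Suc k)" "\<forall>\<beta>'<a k. g \<beta>' < a (Suc k)" for k
      using s[OF a[of k]] by (auto simp: a_def)
    obtain \<beta>0 where \<beta>0: "\<beta>0 < \<kappa>" "\<forall>x\<in>range a. x < \<beta>0"
      using bdd[of "range a"] a unc ordLeq_ordLess_trans[OF card_of_image[of a UNIV]] by blast
    \<comment> \<open>The least strict bound of a strictly increasing sequence is its supremum, so
      every \<beta> < \<delta> is at most some \<open>a k\<close>.\<close>
    define \<delta> where "\<delta> = (LEAST \<delta>. \<forall>k. a k < \<delta>)"
    have \<delta>: "a k < \<delta>" for k
      unfolding \<delta>_def by (rule LeastI2[of _ \<beta>0]) (use \<beta>0 in auto)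
    have "\<delta> \<le> \<beta>0" unfolding \<delta>_def by (rule Least_le) (use \<beta>0 in auto)
    then have "\<delta> < \<kappa>" using \<beta>0 by simp
    moreover have "g \<beta> \<le> \<delta>" if "\<beta> < \<delta>" for \<beta>
    proof -
      have "\<exists>k. \<beta> \<le> a k"
        using not_less_Least[of \<beta> "\<lambda>\<delta>. \<forall>k. a k < \<delta>"] that unfolding \<delta>_def by (auto simp: not_less)
      then obtain k where "\<beta> \<le> a k" by blast
      then have "\<beta> < a (Suc k)" using a_Suc(1) by (rule le_less_trans)
      then have "g \<beta> < a (Suc (Suc k))" using a_Suc(2) by blast
      with \<delta> show ?thesis by (meson less_le_trans order.strict_implies_order order.strict_trans)
    qed
    moreover have "\<alpha> < \<delta>" using \<delta>[of 0] by (simp add: a_def)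
    ultimately show ?thesis by blast
  qed
  moreover have "\<delta> \<in> ?D" if "\<delta> < \<kappa>" "unbounded_in \<delta> ?D" for \<delta>
  proof -
    have "g \<beta> \<le> \<delta>" if \<beta>: "\<beta> < \<delta>" for \<beta>
    proof -
      obtain \<delta>' where "\<delta>' \<in> ?D" "\<beta> < \<delta>'" "\<delta>' < \<delta>"
        using \<open>unbounded_in \<delta> ?D\<close> \<beta> unfolding unbounded_in_def by blast
      then show ?thesis by force
    qed
    with that show ?thesis by blast
  qed
  ultimately show ?thesis unfolding club_in_def unbounded_in_def by blast
qed


subsection \<open>The alephs\<close>

lemma is_aleph_infinite: "is_aleph n \<alpha> \<Longrightarrow> infinite {..<\<alpha>}"
proof (induction n arbitrary: \<alpha>)
  case (Suc n)
  then obtain \<gamma> :: 'a where "is_aleph n \<gamma>" "|{..<\<gamma>}| <o |{..<\<alpha>}|" by auto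
  with Suc.IH show ?case
    using card_of_ordLeq_infinite ordLess_imp_ordLeq by blast
qed simp

lemma is_aleph_unique: "is_aleph n \<alpha> \<Longrightarrow> is_aleph n \<beta> \<Longrightarrow> \<alpha> = \<beta>"
proof (induction n arbitrary: \<alpha> \<beta>)
  case 0
  then show ?case by (metis is_aleph.simps(1) linorder_less_linear)
next
  case (Suc n)
  then obtain \<gamma> :: 'a where \<gamma>: "is_aleph n \<gamma>" "|{..<\<gamma>}| <o |{..<\<alpha>}|" "\<forall>\<delta><\<alpha>. |{..<\<delta>}| \<le>o |{..<\<gamma>}|"
    "|{..<\<gamma>}| <o |{..<\<beta>}|" "\<forall>\<delta><\<beta>. |{..<\<delta>}| \<le>o |{..<\<gamma>}|"
    by (metis is_aleph.simps(2))
  then show ?case by (metis linorder_less_linear not_ordLess_ordLeq)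
qed

locale aleph_universe =
  fixes universe :: "'a::wellorder itself"
  assumes has_aleph_omega: "has_aleph_omega universe"
begin

abbreviation al :: "nat \<Rightarrow> 'a" where "al \<equiv> aleph"

lemma is_aleph_al: "is_aleph n (al n)"
proof -
  obtain \<beta> :: 'a where "is_aleph n \<beta>"
    using has_aleph_omega unfolding has_aleph_omega_def by blast
  then show ?thesis
    unfolding aleph_def using is_aleph_unique by (metis (mono_tags, lifting) theI)
qed

lemma infinite_al: "infinite {..<al n}"
  by (rule is_aleph_infinite[OF is_aleph_al])

lemma al_Suc_card:
  "|{..<al n}| <o |{..<al (Suc n)}|" "\<beta> < al (Suc n) \<Longrightarrow> |{..<\<beta>}| \<le>o |{..<al n}|"
proof -
  obtain \<gamma> :: 'a where "is_aleph n \<gamma>" "|{..<\<gamma>}| <o |{..<al (Suc n)}|"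
    "\<forall>\<beta><al (Suc n). |{..<\<beta>}| \<le>o |{..<\<gamma>}|"
    using is_aleph_al[of "Suc n"] by auto
  then show "|{..<al n}| <o |{..<al (Suc n)}|" "\<beta> < al (Suc n) \<Longrightarrow> |{..<\<beta>}| \<le>o |{..<al n}|"
    using is_aleph_unique[OF is_aleph_al[of n]] by auto
qed

lemma al_initial: "\<beta> < al n \<Longrightarrow> |{..<\<beta>}| <o |{..<al n}|"
proof (cases n)
  case 0
  then show "\<beta> < al n \<Longrightarrow> ?thesis"
    using is_aleph_al[of 0]
    by (intro finite_ordLess_infinite card_of_Well_order) (auto simp: Field_card_of)
next
  case (Suc k)
  then show "\<beta> < al n \<Longrightarrow> ?thesis"
    using al_Suc_card ordLeq_ordLess_trans by blast
qed

lemma al_less_Suc: "al n < al (Suc n)"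
proof (rule ccontr)
  assume "\<not> al n < al (Suc n)"
  then have "|{..<al (Suc n)}| \<le>o |{..<al n}|" by (intro card_of_mono1) auto
  then show False using al_Suc_card(1) not_ordLess_ordLeq by blast
qed

lemma strict_mono_al: "strict_mono al"
  using al_less_Suc by (simp add: strict_mono_Suc_iff)

lemma al_less: "i < j \<Longrightarrow> al i < al j"
  using strict_mono_al by (simp add: strict_mono_less)

lemma al_le: "i \<le> j \<Longrightarrow> al i \<le> al j"
  using strict_mono_al by (simp add: strict_mono_less_eq)

lemma card_al_le: "i \<le> j \<Longrightarrow> |{..<al i}| \<le>o |{..<al j}|"
  using al_le by (intro card_of_mono1) auto

lemma card_al_less: "i < j \<Longrightarrow> |{..<al i}| <o |{..<al j}|"
  by (rule al_initial[OF al_less])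

lemma al_less_aleph_omega: "al n < aleph_omega"
proof -
  obtain \<alpha> :: 'a where \<alpha>: "\<forall>n. \<exists>\<beta><\<alpha>. is_aleph n \<beta>"
    using has_aleph_omega unfolding has_aleph_omega_def by blast
  then have "\<forall>n. al n < \<alpha>"
    using is_aleph_unique[OF is_aleph_al] by metis
  then have "\<forall>n. al n < aleph_omega"
    unfolding aleph_omega_def by (rule LeastI)
  then show ?thesis ..
qed

lemma card_less_al_Suc: "|X| <o |{..<al (Suc n)}| \<longleftrightarrow> |X| \<le>o |{..<al n}|"
proof
  assume "|X| <o |{..<al (Suc n)}|"
  then obtain \<beta> where "\<beta> < al (Suc n)" "|X| =o |{..<\<beta>}|"
    using card_of_ordLess_lessThan by metis
  then show "|X| \<le>o |{..<al n}|"
    using al_Suc_card(2) ordIso_ordLeq_trans by blast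
next
  assume "|X| \<le>o |{..<al n}|"
  then show "|X| <o |{..<al (Suc n)}|" using al_Suc_card(1) ordLeq_ordLess_trans by blast
qed

text \<open>The segments \<open>{..x}\<close> with \<open>x \<in> X\<close> do not cover
  \<open>{..<al n}\<close>: their union is finite for \<open>n = 0\<close>, and of size at most
  \<open>al k\<close> for \<open>n = Suc k\<close>. Any uncovered ordinal bounds
  \<open>X\<close>.\<close>

lemma regular_al: "regular (al n)"
  unfolding regular_def
proof (intro conjI allI impI infinite_al)
  fix X assume X: "X \<subseteq> {..<al n}" "|X| <o |{..<al n}|"
  have "\<exists>\<beta><al n. \<forall>x\<in>X. x < \<beta>"
  proof (cases n)
    case 0
    have X': "finite X"
    proof (rule ccontr)
      assume "infinite X"
      obtain \<beta> where \<beta>: "\<beta> < al n" "|X| =o |{..<\<beta>}|"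
        using card_of_ordLess_lessThan[OF X(2)] by metis
      then have "infinite {..<\<beta>}" using \<open>infinite X\<close> card_of_ordIso_finite by blast
      then show False using \<beta>(1) 0 is_aleph_al[of 0] by auto
    qed
    have "finite (\<Union>x\<in>X. {..x})"
    proof (rule finite_UN_I[OF X'])
      fix x assume "x \<in> X"
      then have "finite {..<x}" using 0 X is_aleph_al[of 0] by auto
      moreover have "{..x} = insert x {..<x}" by auto
      ultimately show "finite {..x}" by simp
    qed
    then have "\<not> {..<al n} \<subseteq> (\<Union>x\<in>X. {..x})"
      using infinite_al finite_subset by metis
    then obtain \<beta> where "\<beta> < al n" "\<beta> \<notin> (\<Union>x\<in>X. {..x})" by auto
    then show ?thesis by (auto simp: not_le)
  next
    case (Suc k)
    have "|\<Union>x\<in>X. {..x}| \<le>o |{..<al k}|"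
    proof (rule card_of_UN_le[OF infinite_al])
      show "|X| \<le>o |{..<al k}|" using X(2) Suc by (simp add: card_less_al_Suc)
      fix x assume "x \<in> X"
      then have "|{..<x}| \<le>o |{..<al k}|" using X(1) Suc al_Suc_card(2) by auto
      then have "|{..<x} \<union> {x}| \<le>o |{..<al k}|"
        using card_of_Un_le[OF infinite_al _ card_of_finite_le[OF infinite_al]] by blast
      moreover have "{..<x} \<union> {x} = {..x}" by auto
      ultimately show "|{..x}| \<le>o |{..<al k}|" by simp
    qed
    then have "|\<Union>x\<in>X. {..x}| <o |{..<al n}|" using Suc by (simp add: card_less_al_Suc)
    then have "\<not> {..<al n} \<subseteq> (\<Union>x\<in>X. {..x})"
      using card_of_mono1 not_ordLess_ordLeq by blast
    then obtain \<beta> where "\<beta> < al n" "\<beta> \<notin> (\<Union>x\<in>X. {..x})" by auto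
    then show ?thesis by (auto simp: not_le)
  qed
  then show "\<exists>\<beta><al n. \<forall>x\<in>X. x < \<beta>" .
qed

lemma card_Pow_al:
  assumes "gch universe"
  shows "|Pow {..<al n}| \<le>o |{..<al (Suc n)}|"
proof -
  have "|Pow {..<al n}| =o cardSuc |{..<al n}|"
    using assms infinite_al unfolding gch_def by blast
  moreover have "cardSuc |{..<al n}| \<le>o |{..<al (Suc n)}|"
    using cardSuc_least card_of_Card_order al_Suc_card(1) by blast
  ultimately show ?thesis using ordIso_ordLeq_trans by blast
qed

text \<open>Cantor's theorem; it allows ordinals below \<open>al (Suc n)\<close> to be coded by
  subsets of \<open>al n\<close>.\<close>

lemma card_al_Suc_le_Pow: "|{..<al (Suc n)}| \<le>o |Pow {..<al n}|"
proof (rule ccontr)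
  assume "\<not> ?thesis"
  then have "|Pow {..<al n}| <o |{..<al (Suc n)}|"
    using not_ordLeq_iff_ordLess[OF card_of_Well_order card_of_Well_order] by metis
  then have "|Pow {..<al n}| \<le>o |{..<al n}|" by (simp only: card_less_al_Suc)
  then show False using card_of_Pow not_ordLess_ordLeq by metis
qed

lemma card_nat_less_al:
  assumes "0 < n" shows "|UNIV :: nat set| <o |{..<al n}|"
proof -
  have "|UNIV :: nat set| \<le>o |{..<al 0}|" by (rule card_of_nat_le[OF infinite_al])
  then show ?thesis using card_al_less[OF assms] ordLeq_ordLess_trans by blast
qed

lemma bounded_below_al:
  assumes "|X| <o |{..<al n}|"
  shows "\<exists>\<beta><al n. \<forall>x\<in>X \<inter> {..<al n}. x < \<beta>"
proof -
  have "|X \<inter> {..<al n}| \<le>o |X|" by (rule card_of_mono1) simp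
  then have "|X \<inter> {..<al n}| <o |{..<al n}|" using assms by (rule ordLeq_ordLess_trans)
  then show ?thesis using regular_al[of n] unfolding regular_def by simp
qed

end

subsection \<open>Closure under a function on finite sets\<close>

definition hull_step :: "('a set \<Rightarrow> 'a set) \<Rightarrow> 'a set \<Rightarrow> 'a set" where
  "hull_step g X = (\<Union>s\<in>{s. finite s \<and> s \<subseteq> X}. g s)"

definition hull :: "('a set \<Rightarrow> 'a set) \<Rightarrow> 'a set \<Rightarrow> 'a set" where
  "hull g X = (\<Union>k. (hull_step g ^^ k) X)"

lemma hull_step_mono: "X \<subseteq> Y \<Longrightarrow> hull_step g X \<subseteq> hull_step g Y"
  unfolding hull_step_def by blast

lemma hull_step_pow_mono: "X \<subseteq> Y \<Longrightarrow> (hull_step g ^^ k) X \<subseteq> (hull_step g ^^ k) Y"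
  by (induction k) (simp_all add: hull_step_mono)

lemma hull_mono: "X \<subseteq> Y \<Longrightarrow> hull g X \<subseteq> hull g Y"
  unfolding hull_def by (intro UN_mono hull_step_pow_mono) auto

lemma subset_hull: "X \<subseteq> hull g X"
  unfolding hull_def by (rule order_trans[OF _ UN_upper[of 0]]) auto

text \<open>By induction on the stage: an element of a new stage lies in \<open>g t\<close> for a
  finite \<open>t\<close>, and the finite supports of the members of \<open>t\<close> have a finite
  union.\<close>

lemma hull_finitary:
  assumes "x \<in> hull g X"
  obtains s where "finite s" "s \<subseteq> X" "x \<in> hull g s"
proof -
  have "\<exists>s. finite s \<and> s \<subseteq> X \<and> x \<in> (hull_step g ^^ k) s" if "x \<in> (hull_step g ^^ k) X" for k x
    using that
  proof (induction k arbitrary: x)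
    case 0
    then show ?case by (intro exI[of _ "{x}"]) auto
  next
    case (Suc k)
    then have "x \<in> hull_step g ((hull_step g ^^ k) X)" by simp
    then obtain t where t: "finite t" "t \<subseteq> (hull_step g ^^ k) X" "x \<in> g t"
      unfolding hull_step_def[of g "(hull_step g ^^ k) X"] by blast
    then have "\<forall>y\<in>t. \<exists>s. finite s \<and> s \<subseteq> X \<and> y \<in> (hull_step g ^^ k) s"
      using Suc.IH by blast
    then obtain S where S: "\<And>y. y \<in> t \<Longrightarrow> finite (S y) \<and> S y \<subseteq> X \<and> y \<in> (hull_step g ^^ k) (S y)"
      by metis
    let ?s = "\<Union>y\<in>t. S y"
    have "t \<subseteq> (hull_step g ^^ k) ?s"
    proof
      fix y assume "y \<in> t"
      then show "y \<in> (hull_step g ^^ k) ?s"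
        using S[of y] hull_step_pow_mono[of "S y" ?s] by blast
    qed
    then have "x \<in> hull_step g ((hull_step g ^^ k) ?s)"
      unfolding hull_step_def[of g "(hull_step g ^^ k) ?s"] using t(1,3) by blast
    then have "x \<in> (hull_step g ^^ Suc k) ?s" by simp
    moreover have "finite ?s" "?s \<subseteq> X" using t(1) S by auto
    ultimately show ?case by blast
  qed
  moreover obtain k where "x \<in> (hull_step g ^^ k) X" using assms unfolding hull_def by blast
  ultimately obtain s where s: "finite s" "s \<subseteq> X" "x \<in> (hull_step g ^^ k) s" by metis
  have "x \<in> hull g s" unfolding hull_def using s(3) by blast
  with s show ?thesis using that by metis
qed

lemma card_hull_le:
  assumes L: "infinite L" and X: "|X| \<le>o |L|" "X \<subseteq> A"
    and g: "\<And>s. finite s \<Longrightarrow> s \<subseteq> A \<Longrightarrow> |g s| \<le>o |L| \<and> g s \<subseteq> A"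
  shows "|hull g X| \<le>o |L|" "hull g X \<subseteq> A"
proof -
  have "|(hull_step g ^^ k) X| \<le>o |L| \<and> (hull_step g ^^ k) X \<subseteq> A" for k
  proof (induction k)
    case (Suc k)
    have "|hull_step g ((hull_step g ^^ k) X)| \<le>o |L|"
      unfolding hull_step_def[of g "(hull_step g ^^ k) X"]
    proof (rule card_of_UN_le[OF L card_of_finite_subsets_le[OF L]])
      show "|(hull_step g ^^ k) X| \<le>o |L|" using Suc ..
      fix s assume "s \<in> {s. finite s \<and> s \<subseteq> (hull_step g ^^ k) X}"
      then have "finite s" "s \<subseteq> A" using Suc by auto
      then show "|g s| \<le>o |L|" using g by simp
    qed
    moreover have "hull_step g ((hull_step g ^^ k) X) \<subseteq> A"
      unfolding hull_step_def[of g "(hull_step g ^^ k) X"] using Suc g by blast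
    ultimately show ?case by simp
  qed (use X in auto)
  then show "|hull g X| \<le>o |L|" "hull g X \<subseteq> A"
    unfolding hull_def by (auto intro: card_of_UN_le[OF L card_of_nat_le[OF L]])
qed

text \<open>Since \<open>s \<subseteq> g s\<close>, the stages increase; a finite subset of the hull
  therefore lies in one stage, and the next stage contains its value under \<open>g\<close>.\<close>

lemma hull_step_hull:
  assumes g: "\<And>s. finite s \<Longrightarrow> s \<subseteq> A \<Longrightarrow> s \<subseteq> g s" and A: "hull g X \<subseteq> A"
  shows "hull_step g (hull g X) = hull g X"
proof
  have "x \<in> hull_step g (hull g X)" if "x \<in> hull g X" for x
    unfolding hull_step_def using that g[of "{x}"] A by blast
  then show "hull g X \<subseteq> hull_step g (hull g X)" by blast
  have inc: "(hull_step g ^^ k) X \<subseteq> (hull_step g ^^ l) X" if "k \<le> l" for k l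
    using that
  proof (induction rule: dec_induct)
    case (step l)
    have "x \<in> (hull_step g ^^ Suc l) X" if "x \<in> (hull_step g ^^ l) X" for x
    proof -
      have "{x} \<subseteq> A" using that A unfolding hull_def by blast
      then have "x \<in> g {x}" using g[of "{x}"] by auto
      moreover have "finite {x} \<and> {x} \<subseteq> (hull_step g ^^ l) X" using that by simp
      ultimately have "x \<in> hull_step g ((hull_step g ^^ l) X)"
        unfolding hull_step_def[of g "(hull_step g ^^ l) X"] by blast
      then show ?thesis by simp
    qed
    with step show ?case by blast
  qed simp
  show "hull_step g (hull g X) \<subseteq> hull g X"
  proof
    fix x assume "x \<in> hull_step g (hull g X)"
    then obtain s where s: "finite s" "s \<subseteq> hull g X" "x \<in> g s"
      unfolding hull_step_def by blast
    have "\<exists>k. s \<subseteq> (hull_step g ^^ k) X"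
      using s(1,2)
    proof (induction s rule: finite_induct)
      case (insert y s)
      then obtain k l where "s \<subseteq> (hull_step g ^^ k) X" "y \<in> (hull_step g ^^ l) X"
        unfolding hull_def by blast
      then have "insert y s \<subseteq> (hull_step g ^^ max k l) X"
        using inc[of k "max k l"] inc[of l "max k l"] by auto
      then show ?case by blast
    qed simp
    then obtain k where "s \<subseteq> (hull_step g ^^ k) X" by blast
    then have "x \<in> hull_step g ((hull_step g ^^ k) X)"
      unfolding hull_step_def[of g "(hull_step g ^^ k) X"] using s(1,3) by blast
    then have "x \<in> (hull_step g ^^ Suc k) X" by simp
    then show "x \<in> hull g X" unfolding hull_def by blast
  qed
qed

text \<open>
  A set closed under \<open>g\<close> is the union of the values of \<open>g\<close> on its finite subsets. Well-ordering a
  set \<open>Y\<close> in its cardinality exhibits this directed union as that of the chain of the unions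
  belonging to the proper initial segments, which are of smaller cardinality.
\<close>

lemma hull_step_in_club:
  fixes \<mu> :: "'a::wellorder" and A :: "'a set"
  assumes C: "club_in_subsets A \<mu> C"
    and g: "\<And>s. finite s \<Longrightarrow> s \<subseteq> A \<Longrightarrow> g s \<in> C"
      "\<And>s t. finite t \<Longrightarrow> t \<subseteq> A \<Longrightarrow> s \<subseteq> t \<Longrightarrow> g s \<subseteq> g t"
    and Y: "Y \<subseteq> A" "|Y| <o |{..<\<mu>}|"
  shows "hull_step g Y \<in> C"
proof -
  \<comment> \<open>The variable \<open>r\<close> carries the cardinality of \<open>Y\<close>, so
    that the well-founded relation \<open><o\<close> supports an induction covering all smaller
    sets.\<close>
  have "\<forall>Y. Y \<subseteq> A \<longrightarrow> |Y| <o |{..<\<mu>}| \<longrightarrow> r = |Y| \<longrightarrow> hull_step g Y \<in> C" for r :: "'a rel"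
  proof (induction r rule: wf_induct_rule[OF wf_ordLess])
    case (1 r)
    show ?case
    proof (intro allI impI)
      fix Y assume Y: "Y \<subseteq> A" "|Y| <o |{..<\<mu>}|" "r = |Y|"
      show "hull_step g Y \<in> C"
      proof (cases "finite Y")
        case True
        then have "hull_step g Y = g Y"
          using g(2)[of Y] Y(1) unfolding hull_step_def by blast
        then show ?thesis using g(1) True Y(1) by simp
      next
        case False
        let ?S = "\<lambda>y. underS |Y| y"
        let ?X = "(\<lambda>y. hull_step g (?S y)) ` Y"
        have wo: "wo_rel |Y|" by (simp add: wo_rel_def card_of_Well_order)
        have SY: "?S y \<subseteq> Y" for y unfolding underS_def using FieldI1[of _ y "|Y|"] by (auto simp: Field_card_of)
        have "?X \<subseteq> C"
        proof clarify
          fix y assume y: "y \<in> Y"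
          have "|?S y| <o |Y|" using card_of_underS[OF card_of_Card_order] y by (simp add: Field_card_of)
          moreover have "|?S y| <o |{..<\<mu>}|" by (rule ordLess_transitive[OF calculation Y(2)])
          moreover have "?S y \<subseteq> A" using SY Y(1) by blast
          ultimately show "hull_step g (?S y) \<in> C" using 1 Y(3) by metis
        qed
        moreover have "?X \<noteq> {}" using False by auto
        moreover have "chain\<^sub>\<subseteq> ?X"
        proof -
          have "?S x \<subseteq> ?S y \<or> ?S y \<subseteq> ?S x" if "x \<in> Y" "y \<in> Y" for x y
            using wo_rel.underS_ofilter[OF wo] wo_rel.ofilter_linord[OF wo] by blast
          then have "hull_step g (?S x) \<subseteq> hull_step g (?S y) \<or> hull_step g (?S y) \<subseteq> hull_step g (?S x)"
            if "x \<in> Y" "y \<in> Y" for x y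
            using that hull_step_mono by metis
          then show ?thesis unfolding chain_subset_def by blast
        qed
        moreover have "|?X| <o |{..<\<mu>}|"
          by (rule ordLeq_ordLess_trans[OF card_of_image Y(2)])
        ultimately have "\<Union>?X \<in> C" using C unfolding club_in_subsets_def by metis
        moreover have "\<Union>?X = hull_step g Y"
        proof
          have "hull_step g (?S y) \<subseteq> hull_step g Y" for y by (rule hull_step_mono[OF SY])
          then show "\<Union>?X \<subseteq> hull_step g Y" by blast
          \<comment> \<open>An infinite cardinal has no last element, so each finite set fits into a
            proper initial segment.\<close>
          have "\<exists>y\<in>Y. s \<subseteq> ?S y" if "finite s" "s \<subseteq> Y" for s
            using that
          proof (induction s rule: finite_induct)
            case empty
            then show ?case using False by (metis bot.extremum ex_in_conv finite.emptyI)
          next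
            case (insert x s)
            then obtain y where y: "y \<in> Y" "s \<subseteq> ?S y" by blast
            obtain b where b: "b \<in> Y" "x \<noteq> b" "(x, b) \<in> |Y|"
              using infinite_Card_order_limit[OF card_of_Card_order, of Y x] False insert.prems
              by (auto simp: Field_card_of)
            then have "x \<in> ?S b" unfolding underS_def by blast
            moreover have "?S y \<subseteq> ?S b \<or> ?S b \<subseteq> ?S y"
              using wo_rel.underS_ofilter[OF wo] wo_rel.ofilter_linord[OF wo] by blast
            ultimately show ?case using y b(1) by blast
          qed
          then have "g s \<subseteq> \<Union>?X" if "finite s" "s \<subseteq> Y" for s
            using that unfolding hull_step_def by fast
          then show "hull_step g Y \<subseteq> \<Union>?X" unfolding hull_step_def[of g Y] by blast
        qed
        ultimately show ?thesis by simp
      qed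
    qed
  qed
  then show ?thesis using Y by blast
qed

text \<open>Recursion along proper inclusion of finite sets: \<open>g s\<close> is a member of
  \<open>C\<close> above \<open>s\<close> and above the finitely many values \<open>g t\<close> with
  \<open>t \<subset> s\<close>, whose union is still small.\<close>

lemma club_closure_function:
  fixes \<mu> :: "'a::wellorder" and A :: "'a set"
  assumes C: "club_in_subsets A \<mu> C" and inf: "infinite {..<\<mu>}"
  obtains g where "\<And>s. finite s \<Longrightarrow> s \<subseteq> A \<Longrightarrow> g s \<in> C"
    "\<And>s. finite s \<Longrightarrow> s \<subseteq> A \<Longrightarrow> s \<subseteq> g s"
    "\<And>s t. finite t \<Longrightarrow> t \<subseteq> A \<Longrightarrow> s \<subseteq> t \<Longrightarrow> g s \<subseteq> g t"
proof -
  have fin: "|s| <o |{..<\<mu>}|" if "finite s" for s :: "'a set"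
    using that inf by (intro finite_ordLess_infinite card_of_Well_order) (auto simp: Field_card_of)
  have Un: "X \<union> Y \<in> subsets_below A \<mu>" if "X \<in> subsets_below A \<mu>" "Y \<in> subsets_below A \<mu>" for X Y
    using that card_of_Un_ordLess_infinite[OF inf] unfolding subsets_below_def by blast
  define P where "P g s r \<longleftrightarrow> finite s \<and> s \<subseteq> A \<longrightarrow> r \<in> C \<and> s \<subseteq> r \<and> (\<forall>t. t \<subset> s \<longrightarrow> g t \<subseteq> r)"
    for g :: "'a set \<Rightarrow> 'a set" and s r
  have "\<exists>g. \<forall>s. P g s (g s)"
  proof (rule dependent_wf_choice[OF wf_finite_psubset])
    fix f g :: "'a set \<Rightarrow> 'a set" and s r
    assume fg: "\<And>t. (t, s) \<in> finite_psubset \<Longrightarrow> f t = g t"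
    show "P f s r = P g s r"
    proof (cases "finite s")
      case True
      then have "f t = g t" if "t \<subset> s" for t using fg that by (auto simp: finite_psubset_def)
      then show ?thesis unfolding P_def by auto
    qed (auto simp: P_def)
  next
    fix s g assume IH: "\<And>t. (t, s) \<in> finite_psubset \<Longrightarrow> P g t (g t)"
    show "\<exists>r. P g s r"
    proof (cases "finite s \<and> s \<subseteq> A")
      case True
      have sub: "g t \<in> subsets_below A \<mu>" if "t \<subset> s" for t
      proof -
        have "finite t" using that True finite_subset by blast
        then have "g t \<in> C" using IH[of t] that True unfolding P_def finite_psubset_def by auto
        then show ?thesis using C unfolding club_in_subsets_def by blast
      qed
      have "s \<union> (\<Union>t\<in>T. g t) \<in> subsets_below A \<mu>" if "finite T" "T \<subseteq> {t. t \<subset> s}" for T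
        using that
      proof (induction T rule: finite_induct)
        case empty
        then show ?case using True fin unfolding subsets_below_def by auto
      next
        case (insert t T)
        then have "g t \<union> (s \<union> (\<Union>t\<in>T. g t)) \<in> subsets_below A \<mu>"
          using Un[OF sub[of t]] by simp
        then show ?case by (simp add: Un_left_commute)
      qed
      moreover have "finite {t. t \<subset> s}"
        using True finite_subset[of "{t. t \<subset> s}" "Pow s"] by auto
      ultimately have "s \<union> (\<Union>t\<in>{t. t \<subset> s}. g t) \<in> subsets_below A \<mu>" by simp
      then obtain r where "r \<in> C" "s \<union> (\<Union>t\<in>{t. t \<subset> s}. g t) \<subseteq> r"
        using C unfolding club_in_subsets_def by blast
      then show ?thesis unfolding P_def by blast
    qed (auto simp: P_def)
  qed
  then obtain g where g: "\<And>s. P g s (g s)" by blast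
  show ?thesis
  proof (rule that[of g])
    show "g s \<subseteq> g t" if "finite t" "t \<subseteq> A" "s \<subseteq> t" for s t
      using g[of t] that unfolding P_def by (cases "s = t") auto
  qed (use g in \<open>auto simp: P_def\<close>)
qed


subsection \<open>Stabilising functions by moves in the games\<close>

lemma partition_on_fibres: "partition_on X ((\<lambda>x. {y \<in> X. h y = h x}) ` X)"
  unfolding partition_on_def disjoint_def by auto

lemma card_of_fibres_le:
  assumes "h ` X \<subseteq> H"
  shows "|(\<lambda>x. {y \<in> X. h y = h x}) ` X| \<le>o |H|"
proof -
  have "(\<lambda>x. {y \<in> X. h y = h x}) ` X = (\<lambda>v. {y \<in> X. h y = v}) ` (h ` X)" by auto
  then have "|(\<lambda>x. {y \<in> X. h y = h x}) ` X| \<le>o |h ` X|" by (metis card_of_image)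
  then show ?thesis using card_of_mono1[OF assms] ordLeq_transitive by blast
qed

text \<open>This is how a reply of the second player is forced to meet a club.\<close>

lemma positive_meets_filter:
  assumes "B \<in> positive_sets \<kappa> F" "in_filter D F" "D \<subseteq> {..<\<kappa>}"
  shows "B \<inter> D \<noteq> {}"
proof
  assume "B \<inter> D = {}"
  then have "D \<subseteq> {..<\<kappa>} - B" using assms(3) by blast
  then have "in_filter ({..<\<kappa>} - B) F"
    using assms(2) unfolding in_filter_def by (auto elim: eventually_mono)
  then show False using assms(1) unfolding positive_sets_def by blast
qed

context aleph_universe
begin

text \<open>
  Below, \<open>V j \<beta> d\<close> stands for the supremum in \<open>\<aleph>\<^sub>j\<close> of a hull with the additional parameter \<open>\<beta>\<close>,
  which matters only for \<open>j \<in> E\<close>; \<open>c i\<close> is the answer of the second player in the \<open>i\<close>-th game.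
\<close>

lemma stabilise:
  fixes V :: "nat \<Rightarrow> 'a \<Rightarrow> (nat \<Rightarrow> 'a) \<Rightarrow> 'a" and F :: "nat \<Rightarrow> 'a filter"
    and c :: "nat \<Rightarrow> 'a set set \<Rightarrow> 'a set" and X :: "nat \<Rightarrow> 'a set"
  assumes gch: "gch universe"
    and E: "E \<subseteq> {i. nstar < i}" "\<forall>i\<in>E. i + 1 \<notin> E" and nstar: "0 < nstar"
    and e: "finite e" "e \<subseteq> E"
    and X: "\<And>i. i \<in> e \<Longrightarrow> X i \<subseteq> {..<al i}"
    and clubs: "\<And>i C. i \<in> e \<Longrightarrow> club_in (al i) C \<Longrightarrow> in_filter C (F i)"
    and c: "\<And>i P. i \<in> e \<Longrightarrow> partition_on (X i) P \<Longrightarrow> |P| <o |{..<al i}| \<Longrightarrow>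
              c i P \<in> P \<and> c i P \<in> positive_sets (al i) (F i)"
    and loc: "\<And>j \<beta> d d'. (\<And>i. i \<in> e \<Longrightarrow> j < i \<Longrightarrow> d i = d' i) \<Longrightarrow> V j \<beta> d = V j \<beta> d'"
    and R: "\<And>j. R j = (if j \<in> E then {..<al j} else {al 0})"
    and bound: "\<And>j \<beta> d. nstar < j \<Longrightarrow> \<beta> \<in> R j \<Longrightarrow> V j \<beta> d < al j"
  obtains P where "\<And>i. i \<in> e \<Longrightarrow> partition_on (X i) (P i)" "\<And>i. i \<in> e \<Longrightarrow> |P i| <o |{..<al i}|"
    "\<And>j \<beta> d d'. nstar < j \<Longrightarrow> \<beta> \<in> R j \<Longrightarrow> (\<And>i. i \<in> e \<Longrightarrow> d i \<in> c i (P i) \<and> d' i \<in> c i (P i)) \<Longrightarrow>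
       V j \<beta> d = V j \<beta> d'"
    "\<And>j \<beta> d. j \<in> e \<Longrightarrow> (\<And>i. i \<in> e \<Longrightarrow> d i \<in> c i (P i)) \<Longrightarrow> \<beta> < d j \<Longrightarrow> V j \<beta> d \<le> d j"
proof -
  obtain K where K: "\<And>i. i \<in> e \<Longrightarrow> i < K"
    using e(1) by (metis finite_nat_set_iff_bounded)
  \<comment> \<open>The empty set has the empty partition, from which \<open>c\<close> could select
    no part.\<close>
  have "\<exists>x. x \<in> X i" if "i \<in> e" for i
  proof (rule ccontr)
    assume "\<nexists>x. x \<in> X i"
    then have "partition_on (X i) {}" by (simp add: partition_on_def)
    moreover have "|{} :: 'a set set| <o |{..<al i}|"
      by (intro finite_ordLess_infinite card_of_Well_order) (auto simp: Field_card_of infinite_al)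
    ultimately show False using c that by blast
  qed
  then obtain x0 where x0: "\<And>i. i \<in> e \<Longrightarrow> x0 i \<in> X i" by metis
  \<comment> \<open>The invariant of a downward induction: once the games with index at least
    \<open>k\<close> are partitioned, \<open>V\<close> depends only on the parameters below
    \<open>k\<close>, and closure holds from \<open>k\<close> on.\<close>
  define S where "S k P \<longleftrightarrow>
      (\<forall>i\<in>e. k \<le> i \<longrightarrow> partition_on (X i) (P i) \<and> |P i| <o |{..<al i}| ) \<and>
      (\<forall>j \<beta> d d'. nstar < j \<longrightarrow> \<beta> \<in> R j \<longrightarrow> (\<forall>i\<in>e. k \<le> i \<longrightarrow> d i \<in> c i (P i) \<and> d' i \<in> c i (P i)) \<longrightarrow>
         (\<forall>i\<in>e. i < k \<longrightarrow> d i = d' i \<and> d i \<in> X i) \<longrightarrow> V j \<beta> d = V j \<beta> d') \<and>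
      (\<forall>j\<in>e. k \<le> j \<longrightarrow> (\<forall>d \<beta>. (\<forall>i\<in>e. k \<le> i \<longrightarrow> d i \<in> c i (P i)) \<longrightarrow> \<beta> < d j \<longrightarrow> V j \<beta> d \<le> d j))"
    for k P
  have "\<exists>P. S 0 P"
  proof (rule inc_induct[of 0 K])
    show "\<exists>P. S K P"
    proof
      show "S K (\<lambda>_. {})"
        unfolding S_def
      proof (intro conjI ballI allI impI)
        fix j \<beta> d d'
        assume "\<forall>i\<in>e. i < K \<longrightarrow> d i = d' i \<and> d i \<in> X i"
        then show "V j \<beta> d = V j \<beta> d'" using K by (intro loc) simp
      qed (use K in \<open>auto simp: not_le[symmetric]\<close>)
    qed
  next
    fix k assume "\<exists>P. S (Suc k) P"
    then obtain P where P: "S (Suc k) P" ..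
    show "\<exists>P. S k P"
    proof (cases "k \<in> e")
      case False
      then have *: "k \<le> i \<longleftrightarrow> Suc k \<le> i" "i < k \<longleftrightarrow> i < Suc k" if "i \<in> e" for i
        using that by (auto simp: Suc_le_eq le_less less_Suc_eq)
      have "S k P = S (Suc k) P" unfolding S_def using * by (simp cong: ball_cong)
      with P show ?thesis by metis
    next
      case ke: True
      then have kE: "k \<in> E" and "nstar < k" using e E by auto
      \<comment> \<open>As 0 < \<open>nstar\<close> < \<open>k\<close>, the index \<open>q\<close>
        exists. Subsets of \<open>al q\<close> will code the parts, and GCH bounds their number by
        \<open>al (Suc q)\<close>, which is below \<open>al k\<close>.\<close>
      then obtain q where q: "k = Suc (Suc q)"
        using nstar by (metis One_nat_def Suc_lessE less_Suc_eq_0_disj less_trans_Suc not_less_eq)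
      have part: "partition_on (X i) (P i)" "|P i| <o |{..<al i}|" if "i \<in> e" "k < i" for i
        using P that unfolding S_def by auto
      have stab: "V j \<beta> d = V j \<beta> d'"
        if "nstar < j" "\<beta> \<in> R j" "\<And>i. i \<in> e \<Longrightarrow> k < i \<Longrightarrow> d i \<in> c i (P i) \<and> d' i \<in> c i (P i)"
          "\<And>i. i \<in> e \<Longrightarrow> i \<le> k \<Longrightarrow> d i = d' i \<and> d i \<in> X i" for j \<beta> d d'
        using P that unfolding S_def by (metis Suc_le_eq less_Suc_eq_le)
      have clos: "V j \<beta> d \<le> d j"
        if "j \<in> e" "k < j" "\<And>i. i \<in> e \<Longrightarrow> k < i \<Longrightarrow> d i \<in> c i (P i)" "\<beta> < d j" for j \<beta> d
        using P that unfolding S_def by (metis Suc_le_eq)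
      have "\<exists>x. x \<in> c i (P i)" if "i \<in> e" "k < i" for i
        using c[OF that(1) part[OF that]] part(1)[OF that] unfolding partition_on_def by (metis ex_in_conv)
      then obtain d0 where d0: "\<And>i. i \<in> e \<Longrightarrow> k < i \<Longrightarrow> d0 i \<in> c i (P i)" by metis
      \<comment> \<open>Parameters above \<open>k\<close> are frozen at the representatives
        \<open>d0\<close>; by \<open>stab\<close> any other points of the same replies would give
        the same values.\<close>
      define mix where "mix t \<delta> i = (if i < k then t i else if i = k then \<delta> else d0 i)"
        for t :: "nat \<Rightarrow> 'a" and \<delta> i
      \<comment> \<open>The arguments left besides \<delta>. The closed interval accommodates
        \<beta> = \<open>al 0\<close>, the value used for \<open>j \<notin> E\<close>, whatever
        \<open>q\<close> is.\<close>
      define Par where "Par = {..<k} \<times> ({..al q} \<times> Pi\<^sub>E (e \<inter> {..<k}) X)"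
      \<comment> \<open>Here the absence of consecutive elements in \<open>E\<close> enters: it
        keeps the lower parameters within \<open>al q\<close>, so that \<open>Par\<close> has size
        at most \<open>al q\<close>.\<close>
      have iq: "i \<le> q" if "i \<in> E" "i < k" for i
      proof -
        have "i + 1 \<noteq> k" using E(2) that(1) kE by auto
        then show ?thesis using that(2) q by auto
      qed
      have "|Pi\<^sub>E (e \<inter> {..<k}) X| \<le>o |{..<al q}|"
      proof (rule card_of_PiE_le[OF infinite_al])
        show "finite (e \<inter> {..<k})" using e by simp
        fix i assume "i \<in> e \<inter> {..<k}"
        then show "|X i| \<le>o |{..<al q}|"
          using X[of i] iq[of i] e(2) card_al_le[of i q] card_of_subset_le by blast
      qed
      moreover have "{..al q} = {..<al q} \<union> {al q}" by auto
      then have "|{..al q}| \<le>o |{..<al q}|"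
        using card_of_Un_le[OF infinite_al card_of_mono1[OF subset_refl] card_of_finite_le[OF infinite_al]]
        by (metis finite.emptyI finite.insertI)
      moreover have "|{..<k}| \<le>o |{..<al q}|" by (rule card_of_nat_le[OF infinite_al])
      ultimately have "|Par \<times> {..<al q}| \<le>o |{..<al q}|"
        unfolding Par_def using card_of_mono1[OF subset_refl, of "{..<al q}"]
        by (intro card_of_Times_le infinite_al)
      then obtain \<pi> where \<pi>: "inj_on \<pi> (Par \<times> {..<al q})" "\<pi> ` (Par \<times> {..<al q}) \<subseteq> {..<al q}"
        using card_of_ordLeq by metis
      obtain \<iota> where \<iota>: "inj_on \<iota> {..<al (Suc q)}" "\<iota> ` {..<al (Suc q)} \<subseteq> Pow {..<al q}"
        using card_al_Suc_le_Pow card_of_ordLeq by metis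
      \<comment> \<open>\<open>\<Phi> \<delta>\<close> codes the values of all \<open>V j \<beta>\<close>, \<open>j < k\<close>, as one subset of \<open>\<aleph>\<^sub>q\<close>.\<close>
      define \<Phi> where "\<Phi> \<delta> = \<pi> ` {((j, \<beta>, t), a) |j \<beta> t a.
          (j, \<beta>, t) \<in> Par \<and> a < al q \<and> a \<in> \<iota> (V j \<beta> (mix t \<delta>))}" for \<delta>
      \<comment> \<open>\<open>V k\<close> reads only parameters above \<open>k\<close>, so by
        \<open>stab\<close> these are the closure points for every choice from the replies, not only
        for \<open>d0\<close>.\<close>
      define D where "D = {\<delta>. \<delta> < al k \<and> (\<forall>\<beta><\<delta>. V k \<beta> d0 \<le> \<delta>)}"
      define h where "h \<delta> = (\<Phi> \<delta>, \<delta> \<in> D)" for \<delta>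
      define Q where "Q = (\<lambda>x. {y \<in> X k. h y = h x}) ` X k"
      have club: "club_in (al k) D"
        unfolding D_def
      proof (rule club_in_closure_points[OF regular_al card_nat_less_al al_initial])
        show "0 < k" using q by simp
        show "V k \<beta> d0 < al k" if "\<beta> < al k" for \<beta>
          using bound[OF \<open>nstar < k\<close>] R kE that by simp
      qed
      have Q: "partition_on (X k) Q" unfolding Q_def by (rule partition_on_fibres)
      have "|Q| \<le>o |Pow {..<al q} \<times> (UNIV :: bool set)|"
        unfolding Q_def
      proof (rule card_of_fibres_le)
        show "h ` X k \<subseteq> Pow {..<al q} \<times> UNIV"
          using \<pi>(2) by (auto simp: h_def \<Phi>_def)
      qed
      also have "|Pow {..<al q} \<times> (UNIV :: bool set)| \<le>o |{..<al (Suc q)}|"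
        by (intro card_of_Times_le card_of_finite_le card_Pow_al infinite_al gch) auto
      finally have cQ: "|Q| <o |{..<al k}|" by (simp add: q card_less_al_Suc)
      define B where "B = c k Q"
      have B: "B \<in> Q" "B \<in> positive_sets (al k) (F k)"
        using c[OF ke Q cQ] by (auto simp: B_def)
      \<comment> \<open>Since \<open>h\<close> records membership in \<open>D\<close>, the reply
        \<open>B\<close> is contained in \<open>D\<close> or disjoint from it; positivity excludes
        the latter.\<close>
      have "B \<inter> D \<noteq> {}"
        by (rule positive_meets_filter[OF B(2) clubs[OF ke club]]) (auto simp: D_def)
      moreover obtain x where Bx: "B = {y \<in> X k. h y = h x}" using B(1) unfolding Q_def by blast
      ultimately have BD: "B \<subseteq> D" unfolding h_def by auto
      have BX: "B \<subseteq> X k" and Bh: "\<And>y z. y \<in> B \<Longrightarrow> z \<in> B \<Longrightarrow> \<Phi> y = \<Phi> z"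
        using Bx by (auto simp: h_def)
      define P' where "P' = P(k := Q)"
      have P'k: "c k (P' k) = B" and P'i: "\<And>i. i \<noteq> k \<Longrightarrow> P' i = P i"
        by (auto simp: P'_def B_def)
      have "S k P'"
        unfolding S_def
      proof (intro conjI ballI allI impI)
        fix i assume "i \<in> e" "k \<le> i"
        then show "partition_on (X i) (P' i)" "|P' i| <o |{..<al i}|"
          using part Q cQ by (cases "i = k"; auto simp: P'_def)+
      next
        fix j \<beta> d d'
        assume j: "nstar < j" "\<beta> \<in> R j"
          and d: "\<forall>i\<in>e. k \<le> i \<longrightarrow> d i \<in> c i (P' i) \<and> d' i \<in> c i (P' i)"
          and dd': "\<forall>i\<in>e. i < k \<longrightarrow> d i = d' i \<and> d i \<in> X i"
        define t where "t = restrict d (e \<inter> {..<k})"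
        have dB: "d k \<in> B" "d' k \<in> B" using d ke P'k by auto
        have dP: "d i \<in> c i (P i)" "d' i \<in> c i (P i)" if "i \<in> e" "k < i" for i
          using d that P'i[of i] by auto
        have 1: "V j \<beta> d = V j \<beta> (mix t (d k))"
          by (rule stab[OF j]) (use dP d0 dB BX dd' in \<open>auto simp: mix_def t_def\<close>)
        have 2: "V j \<beta> d' = V j \<beta> (mix t (d' k))"
          by (rule stab[OF j]) (use dP d0 dB BX dd' in \<open>auto simp: mix_def t_def\<close>)
        have "V j \<beta> (mix t (d k)) = V j \<beta> (mix t (d' k))"
        proof (cases "j < k")
          case True
          have "\<beta> \<le> al q"
            using j(2) R[of j] iq[of j] True al_le[of j q] al_le[of 0 q] by (auto split: if_splits)
          moreover have "t \<in> Pi\<^sub>E (e \<inter> {..<k}) X" using dd' by (auto simp: t_def)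
          ultimately have par: "(j, \<beta>, t) \<in> Par" using True by (simp add: Par_def)
          have V: "V j \<beta> d'' < al (Suc q)" for d''
            using bound[OF j, of d''] al_le[of j "Suc q"] True q by auto
          \<comment> \<open>The section of \<open>\<Phi> y\<close> at \<open>(j, \<beta>, t)\<close>
            turns out to be the code of the value of \<open>V\<close>, by injectivity of
            \<open>\<pi>\<close>. Hence equal \<open>\<Phi>\<close> yield equal values.\<close>
          have sub: "\<iota> (V j \<beta> (mix t y)) \<subseteq> {a. a < al q \<and> \<pi> ((j, \<beta>, t), a) \<in> \<Phi> y}" for y
          proof
            fix a assume a: "a \<in> \<iota> (V j \<beta> (mix t y))"
            then have "a < al q" using V \<iota>(2) by blast
            with a par show "a \<in> {a. a < al q \<and> \<pi> ((j, \<beta>, t), a) \<in> \<Phi> y}"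
              unfolding \<Phi>_def by blast
          qed
          have sup: "{a. a < al q \<and> \<pi> ((j, \<beta>, t), a) \<in> \<Phi> y} \<subseteq> \<iota> (V j \<beta> (mix t y))" for y
          proof
            fix a assume a: "a \<in> {a. a < al q \<and> \<pi> ((j, \<beta>, t), a) \<in> \<Phi> y}"
            then obtain j' \<beta>' t' a' where *: "\<pi> ((j, \<beta>, t), a) = \<pi> ((j', \<beta>', t'), a')"
              "(j', \<beta>', t') \<in> Par" "a' < al q" "a' \<in> \<iota> (V j' \<beta>' (mix t' y))"
              unfolding \<Phi>_def by blast
            then have "((j, \<beta>, t), a) = ((j', \<beta>', t'), a')"
              using par a by (intro inj_onD[OF \<pi>(1)]) auto
            with *(4) show "a \<in> \<iota> (V j \<beta> (mix t y))" by simp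
          qed
          have "\<iota> (V j \<beta> (mix t y)) = {a. a < al q \<and> \<pi> ((j, \<beta>, t), a) \<in> \<Phi> y}" for y
            using sub sup by (rule subset_antisym)
          then have "\<iota> (V j \<beta> (mix t (d k))) = \<iota> (V j \<beta> (mix t (d' k)))"
            using Bh[OF dB] by simp
          then show ?thesis using inj_onD[OF \<iota>(1)] V by (metis lessThan_iff)
        next
          case False
          then show ?thesis by (intro loc) (auto simp: mix_def)
        qed
        with 1 2 show "V j \<beta> d = V j \<beta> d'" by simp
      next
        fix j d \<beta> assume j: "j \<in> e" "k \<le> j" and d: "\<forall>i\<in>e. k \<le> i \<longrightarrow> d i \<in> c i (P' i)" and \<beta>: "\<beta> < d j"
        have dP: "d i \<in> c i (P i)" if "i \<in> e" "k < i" for i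
          using d that P'i[of i] by auto
        show "V j \<beta> d \<le> d j"
        proof (cases "j = k")
          case True
          have dk: "d k \<in> D" "d k \<in> X k" using d ke P'k BD BX by auto
          have "\<beta> \<in> R k" using \<beta> True R kE dk X[OF ke] by auto
          \<comment> \<open>\<open>V k\<close> does not read parameters up to \<open>k\<close>;
            replacing them by \<open>x0\<close> makes them agree and lie in \<open>X\<close>, as
            \<open>stab\<close> demands.\<close>
          have "V k \<beta> d = V k \<beta> (\<lambda>i. if i \<le> k then x0 i else d i)"
            by (intro loc) auto
          also have "\<dots> = V k \<beta> (\<lambda>i. if i \<le> k then x0 i else d0 i)"
            by (rule stab[OF \<open>nstar < k\<close> \<open>\<beta> \<in> R k\<close>]) (use dP d0 x0 in auto)
          also have "\<dots> = V k \<beta> d0" by (intro loc) auto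
          finally show ?thesis using dk(1) \<beta> True unfolding D_def by simp
        next
          case False
          then show ?thesis using clos j dP \<beta> by auto
        qed
      qed
      then show ?thesis by blast
    qed
  qed auto
  then obtain P where P: "S 0 P" ..
  show ?thesis
    by (rule that[of P]) (use P in \<open>unfold S_def, auto\<close>)
qed

end


subsection \<open>Playing the games simultaneously\<close>

lemma first_legal_cong:
  assumes "P \<xi> = P' \<xi>" "\<And>\<eta>. \<eta> < \<xi> \<Longrightarrow> B \<eta> = B' \<eta>"
  shows "first_legal \<kappa> D P B \<xi> = first_legal \<kappa> D P' B' \<xi>"
proof -
  have "(\<Inter>\<eta>\<in>{..<\<xi>}. B \<eta>) = (\<Inter>\<eta>\<in>{..<\<xi>}. B' \<eta>)" using assms(2) by (intro INF_cong) auto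
  then show ?thesis unfolding first_legal_def using assms(1) by simp
qed

lemma follows_cong:
  assumes "\<And>\<eta>. \<eta> \<le> \<xi> \<Longrightarrow> P \<eta> = P' \<eta>" "\<And>\<eta>. \<eta> \<le> \<xi> \<Longrightarrow> B \<eta> = B' \<eta>"
  shows "follows \<sigma> P B \<xi> = follows \<sigma> P' B' \<xi>"
proof -
  have "restrict P {..\<xi>} = restrict P' {..\<xi>}" "restrict B {..<\<xi>} = restrict B' {..<\<xi>}"
    using assms by (auto simp: restrict_def fun_eq_iff)
  then show ?thesis unfolding follows_def using assms(2)[of \<xi>] by simp
qed

lemma winning_strategy_legal:
  assumes "winning_strategy \<theta> \<kappa> D \<sigma>" "\<xi> < \<theta>"
    "\<And>\<eta>. \<eta> \<le> \<xi> \<Longrightarrow> first_legal \<kappa> D P B \<eta> \<and> follows \<sigma> P B \<eta>"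
  shows "second_legal \<kappa> D P B \<xi>"
  using assms unfolding winning_strategy_def by blast

text \<open>At move 0 the intersection over no moves would be the whole type; there the first player
  takes \<open>W\<close> as the set to partition.\<close>

definition position :: "'a set \<Rightarrow> ('a::wellorder \<Rightarrow> 'a set) \<Rightarrow> 'a \<Rightarrow> 'a set" where
  "position W B \<xi> = (if {..<\<xi>} = {} then W else \<Inter>\<eta>\<in>{..<\<xi>}. B \<eta>)"

text \<open>The reply as a function of a hypothetical partition \<open>Q\<close>. It serves as
  \<open>c\<close> in \<open>stabilise\<close>, where partitions are chosen with the replies in
  view.\<close>

definition answer ::
  "'a::wellorder strategy \<Rightarrow> ('a \<Rightarrow> 'a set set) \<Rightarrow> ('a \<Rightarrow> 'a set) \<Rightarrow> 'a \<Rightarrow> 'a set set \<Rightarrow> 'a set" where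
  "answer \<sigma> P B \<xi> Q = \<sigma> \<xi> (restrict (P(\<xi> := Q)) {..\<xi>}) (restrict B {..<\<xi>})"

text \<open>The extended play agrees with the legal history before \<xi>, so the winning strategy
  must choose legally at \<xi>.\<close>

lemma answer_legal:
  fixes \<xi> :: "'a::wellorder"
  assumes win: "winning_strategy \<theta> \<kappa> D \<sigma>" and \<xi>: "\<xi> < \<theta>" and W: "W \<in> positive_sets \<kappa> D"
    and hist: "\<And>\<eta>. \<eta> < \<xi> \<Longrightarrow> first_legal \<kappa> D P B \<eta> \<and> follows \<sigma> P B \<eta>"
    and Q: "partition_on (position W B \<xi>) Q" "|Q| <o |{..<\<kappa>}|"
  shows "first_legal \<kappa> D (P(\<xi> := Q)) (B(\<xi> := answer \<sigma> P B \<xi> Q)) \<xi>"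
    "follows \<sigma> (P(\<xi> := Q)) (B(\<xi> := answer \<sigma> P B \<xi> Q)) \<xi>"
    "answer \<sigma> P B \<xi> Q \<in> Q" "answer \<sigma> P B \<xi> Q \<in> positive_sets \<kappa> D"
proof -
  let ?P = "P(\<xi> := Q)" and ?B = "B(\<xi> := answer \<sigma> P B \<xi> Q)"
  have "restrict ?B {..<\<xi>} = restrict B {..<\<xi>}" by (auto simp: restrict_def fun_eq_iff)
  then show follows: "follows \<sigma> ?P ?B \<xi>" by (simp add: follows_def answer_def)
  have "(\<Inter>\<eta>\<in>{..<\<xi>}. ?B \<eta>) = (\<Inter>\<eta>\<in>{..<\<xi>}. B \<eta>)" by (intro INF_cong) auto
  then show legal: "first_legal \<kappa> D ?P ?B \<xi>"
    using Q W unfolding first_legal_def position_def by (auto split: if_splits)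
  have "first_legal \<kappa> D ?P ?B \<eta> \<and> follows \<sigma> ?P ?B \<eta>" if "\<eta> \<le> \<xi>" for \<eta>
  proof (cases "\<eta> = \<xi>")
    case False
    then have "\<eta> < \<xi>" using that by simp
    moreover have "first_legal \<kappa> D ?P ?B \<eta> = first_legal \<kappa> D P B \<eta>"
      by (rule first_legal_cong) (use \<open>\<eta> < \<xi>\<close> in auto)
    moreover have "follows \<sigma> ?P ?B \<eta> = follows \<sigma> P B \<eta>"
      by (rule follows_cong) (use \<open>\<eta> < \<xi>\<close> in auto)
    ultimately show ?thesis using hist by blast
  qed (use follows legal in auto)
  then have "second_legal \<kappa> D ?P ?B \<xi>" using winning_strategy_legal[OF win \<xi>] by blast
  then show "answer \<sigma> P B \<xi> Q \<in> Q" "answer \<sigma> P B \<xi> Q \<in> positive_sets \<kappa> D"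
    unfolding second_legal_def by auto
qed

text \<open>The partitions, the answers, and the new generators at each move.\<close>

type_synonym 'a play = "'a \<Rightarrow> (nat \<Rightarrow> 'a set set) \<times> (nat \<Rightarrow> 'a set) \<times> (nat \<Rightarrow> 'a)"

text \<open>The function \<open>g\<close> will come from a given club. The size bound on
  \<open>cofs\<close> covers all ordinals, so suprema of hulls are controlled for arbitrary
  parameters.\<close>

locale cofinality_games = aleph_universe universe
  for universe :: "'a::wellorder itself" +
  fixes m nstar :: nat and E :: "nat set" and n :: "nat \<Rightarrow> nat"
    and F :: "nat \<Rightarrow> 'a filter" and \<sigma> :: "nat \<Rightarrow> 'a strategy"
    and g :: "'a set \<Rightarrow> 'a set" and cofs :: "'a \<Rightarrow> 'a set" and level :: "'a \<Rightarrow> nat"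
  assumes gch: "gch universe" and m: "m < nstar"
    and E: "E \<subseteq> {i. nstar < i}" "\<forall>i\<in>E. i + 1 \<notin> E" and n: "\<forall>i\<in>E. n i < nstar"
    and clubs: "\<And>i C. i \<in> E \<Longrightarrow> club_in (al i) C \<Longrightarrow> in_filter C (F i)"
    and positive: "\<And>i. i \<in> E \<Longrightarrow>
      {\<alpha>. \<alpha> < al i \<and> cf {..<\<alpha>} = al (n i)} \<in> positive_sets (al i) (F i)"
    and win: "\<And>i. i \<in> E \<Longrightarrow> winning_strategy (al m) (al i) (F i) (\<sigma> i)"
    and g: "\<And>s. finite s \<Longrightarrow> s \<subseteq> {..<aleph_omega} \<Longrightarrow>
      g s \<subseteq> {..<aleph_omega} \<and> |g s| \<le>o |{..<al nstar}|"
    and cofs: "\<And>\<delta>. cofs \<delta> \<subseteq> {..<aleph_omega}" "\<And>\<delta>. |cofs \<delta>| \<le>o |{..<al nstar}|"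
      "\<And>\<delta>. \<delta> < aleph_omega \<Longrightarrow> \<exists>k<nstar. cf {..<\<delta>} = al k \<Longrightarrow>
         cofs \<delta> \<subseteq> {..<\<delta>} \<and> (\<forall>x<\<delta>. \<exists>a\<in>cofs \<delta>. x \<le> a)"
    and level: "\<And>k \<xi>. \<xi> < al m \<Longrightarrow> \<exists>\<xi>'. \<xi> \<le> \<xi>' \<and> \<xi>' < al m \<and> level \<xi>' = k"
begin

definition W :: "nat \<Rightarrow> 'a set" where "W i = {\<alpha>. \<alpha> < al i \<and> cf {..<\<alpha>} = al (n i)}"

text \<open>
  The initial segment \<open>\<aleph>\<^bsub>j-1\<^esub>\<close> absorbs the cofinal subsets of all \<open>d i\<close> with \<open>i < j\<close>.
\<close>

definition gens :: "'a set \<Rightarrow> nat set \<Rightarrow> nat \<Rightarrow> 'a \<Rightarrow> (nat \<Rightarrow> 'a) \<Rightarrow> 'a set" where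
  "gens \<Gamma> e j \<beta> d = {..<\<beta>} \<union> {..<al (j - 1)} \<union> \<Gamma> \<union> (\<Union>i\<in>{i \<in> e. j < i}. cofs (d i))"

text \<open>A strict bound is taken so that earlier terms of the sequence in \<open>al j\<close>,
  being generators, lie strictly below the new one.\<close>

definition V :: "'a set \<Rightarrow> nat set \<Rightarrow> nat \<Rightarrow> 'a \<Rightarrow> (nat \<Rightarrow> 'a) \<Rightarrow> 'a" where
  "V \<Gamma> e j \<beta> d = (LEAST v. \<forall>x\<in>hull g (gens \<Gamma> e j \<beta> d) \<inter> {..<al j}. x < v)"

text \<open>The hull has at most \<open>al (j - 1)\<close> elements, so regularity of
  \<open>al j\<close> bounds its trace.\<close>

lemma V_bound:
  assumes j: "nstar < j" and \<beta>: "\<beta> < al j"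
    and \<Gamma>: "\<Gamma> \<subseteq> {..<aleph_omega}" "|\<Gamma>| \<le>o |{..<al nstar}|"
  shows "V \<Gamma> e j \<beta> d < al j" "x \<in> hull g (gens \<Gamma> e j \<beta> d) \<Longrightarrow> x < al j \<Longrightarrow> x < V \<Gamma> e j \<beta> d"
proof -
  obtain k where k: "j = Suc k" using j by (cases j) auto
  have le: "|A| \<le>o |{..<al k}|" if "|A| \<le>o |{..<al nstar}|" for A :: "'a set"
    using that card_al_le[of nstar k] j k ordLeq_transitive by auto
  have "|{..<\<beta>}| \<le>o |{..<al k}|" using al_Suc_card(2) \<beta> k by simp
  moreover have "|{..<al (j - 1)}| \<le>o |{..<al k}|" using card_of_mono1[OF subset_refl] k by auto
  moreover have "|\<Union>i\<in>{i \<in> e. j < i}. cofs (d i)| \<le>o |{..<al k}|"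
    by (rule card_of_UN_le[OF infinite_al card_of_nat_le[OF infinite_al] le[OF cofs(2)]])
  ultimately have "|gens \<Gamma> e j \<beta> d| \<le>o |{..<al k}|"
    unfolding gens_def using le[OF \<Gamma>(2)] by (intro card_of_Un_le infinite_al)
  moreover have "gens \<Gamma> e j \<beta> d \<subseteq> {..<aleph_omega}"
    using \<beta> \<Gamma>(1) cofs(1) al_less_aleph_omega[of j] al_less_aleph_omega[of "j - 1"]
    unfolding gens_def by fastforce
  ultimately have "|hull g (gens \<Gamma> e j \<beta> d)| \<le>o |{..<al k}|"
    by (rule card_hull_le(1)[OF infinite_al]) (use g le in blast)
  then have "|hull g (gens \<Gamma> e j \<beta> d)| <o |{..<al j}|" by (simp add: k card_less_al_Suc)
  then obtain v where v: "v < al j" "\<forall>x\<in>hull g (gens \<Gamma> e j \<beta> d) \<inter> {..<al j}. x < v"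
    using bounded_below_al by blast
  have "V \<Gamma> e j \<beta> d \<le> v" unfolding V_def using v(2) by (rule Least_le)
  then show "V \<Gamma> e j \<beta> d < al j" using v(1) by simp
  have "\<forall>x\<in>hull g (gens \<Gamma> e j \<beta> d) \<inter> {..<al j}. x < V \<Gamma> e j \<beta> d"
    unfolding V_def using v(2) by (rule LeastI)
  then show "x \<in> hull g (gens \<Gamma> e j \<beta> d) \<Longrightarrow> x < al j \<Longrightarrow> x < V \<Gamma> e j \<beta> d" by blast
qed

section \<open>Simultaneous plays by transfinite recursion\<close>

definition ps :: "'a play \<Rightarrow> nat \<Rightarrow> 'a \<Rightarrow> 'a set set"
  where "ps h i \<eta> = fst (h \<eta>) i"

definition bs :: "'a play \<Rightarrow> nat \<Rightarrow> 'a \<Rightarrow> 'a set"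
  where "bs h i \<eta> = fst (snd (h \<eta>)) i"

definition gs :: "'a play \<Rightarrow> nat \<Rightarrow> 'a \<Rightarrow> 'a"
  where "gs h j \<eta> = snd (snd (h \<eta>)) j"

definition below :: "'a play \<Rightarrow> 'a \<Rightarrow> 'a set"
  where "below h \<xi> = (\<Union>j\<in>{j. nstar < j \<and> j \<notin> E}. gs h j ` {..<\<xi>})"

text \<open>
  Only finitely many \<open>\<delta>\<^sub>i\<close> can be handled at one move. Since \<open>level\<close> takes each value cofinally often,
  every finite set of generators is nevertheless considered at some later move.
\<close>

definition active :: "'a \<Rightarrow> nat set" where "active \<xi> = {i \<in> E. i \<le> level \<xi>}"

text \<open>The clauses on \<open>V\<close> speak of all choices \<open>d\<close> from the current
  replies, because the final points \<delta>_i are known only after the last move and lie in every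
  reply.\<close>

definition good :: "'a \<Rightarrow> 'a play \<Rightarrow> bool" where
  "good \<xi> h \<longleftrightarrow>
     (\<forall>i\<in>E. first_legal (al i) (F i) (ps h i) (bs h i) \<xi> \<and> follows (\<sigma> i) (ps h i) (bs h i) \<xi> \<and>
        bs h i \<xi> \<subseteq> W i) \<and>
     (\<forall>j d. nstar < j \<longrightarrow> j \<notin> E \<longrightarrow> gs h j \<xi> < al j \<and>
        ((\<forall>i\<in>active \<xi>. d i \<in> bs h i \<xi>) \<longrightarrow> V (below h \<xi>) (active \<xi>) j (al 0) d = gs h j \<xi>)) \<and>
     (\<forall>j\<in>active \<xi>. \<forall>d \<beta>. (\<forall>i\<in>active \<xi>. d i \<in> bs h i \<xi>) \<longrightarrow> \<beta> < d j \<longrightarrow>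
        V (below h \<xi>) (active \<xi>) j \<beta> d \<le> d j)"

lemma good_cong:
  assumes "\<And>\<eta>. \<eta> \<le> \<xi> \<Longrightarrow> h \<eta> = h' \<eta>"
  shows "good \<xi> h = good \<xi> h'"
proof -
  have eq: "ps h i \<eta> = ps h' i \<eta>" "bs h i \<eta> = bs h' i \<eta>" "gs h i \<eta> = gs h' i \<eta>" if "\<eta> \<le> \<xi>" for i \<eta>
    using assms that by (auto simp: ps_def bs_def gs_def)
  have "below h \<xi> = below h' \<xi>"
    unfolding below_def using eq(3) by (intro SUP_cong refl image_cong) auto
  moreover have "first_legal (al i) (F i) (ps h i) (bs h i) \<xi> = first_legal (al i) (F i) (ps h' i) (bs h' i) \<xi>" for i
    using eq by (intro first_legal_cong) auto
  moreover have "follows (\<sigma> i) (ps h i) (bs h i) \<xi> = follows (\<sigma> i) (ps h' i) (bs h' i) \<xi>" for i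
    using eq by (intro follows_cong) auto
  ultimately show ?thesis unfolding good_def using eq[of \<xi>] by simp
qed

lemma below_subset:
  assumes "\<xi> \<le> al m" "\<And>\<eta>. \<eta> < \<xi> \<Longrightarrow> good \<eta> h"
  shows "below h \<xi> \<subseteq> {..<aleph_omega}" "|below h \<xi>| \<le>o |{..<al nstar}|"
proof -
  have "gs h j \<eta> < aleph_omega" if "nstar < j" "j \<notin> E" "\<eta> < \<xi>" for j \<eta>
    using assms(2)[OF that(3)] that al_less_aleph_omega[of j] unfolding good_def by fastforce
  then show "below h \<xi> \<subseteq> {..<aleph_omega}" unfolding below_def by auto
  have "{..<\<xi>} \<subseteq> {..<al nstar}" using assms(1) al_less[OF m] by auto
  then show "|below h \<xi>| \<le>o |{..<al nstar}|"
    unfolding below_def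
    by (intro card_of_UN_le card_of_nat_le card_of_image_le infinite_al card_of_mono1)
qed

text \<open>\<open>stabilise\<close> supplies partitions of the current positions in the finitely
  many active games.\<close>

lemma exists_good_extension:
  assumes \<xi>: "\<xi> < al m" and hist: "\<And>\<eta>. \<eta> < \<xi> \<Longrightarrow> good \<eta> h"
  shows "\<exists>r. good \<xi> (h(\<xi> := r))"
proof -
  let ?X = "\<lambda>i. position (W i) (bs h i) \<xi>" and ?c = "\<lambda>i. answer (\<sigma> i) (ps h i) (bs h i) \<xi>"
  let ?e = "active \<xi>" and ?\<Gamma> = "below h \<xi>"
  let ?R = "\<lambda>j. if j \<in> E then {..<al j} else {al 0}"
  have WX: "?X i \<subseteq> W i" if "i \<in> E" for i
  proof -
    have "bs h i \<eta> \<subseteq> W i" if "\<eta> < \<xi>" for \<eta>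
      using hist[OF that] \<open>i \<in> E\<close> unfolding good_def by blast
    then show ?thesis unfolding position_def by auto
  qed
  have legal: "first_legal (al i) (F i) (ps h i) (bs h i) \<eta> \<and> follows (\<sigma> i) (ps h i) (bs h i) \<eta>"
    if "i \<in> E" "\<eta> < \<xi>" for i \<eta>
    using hist[OF that(2)] that(1) unfolding good_def by blast
  have ans: "first_legal (al i) (F i) ((ps h i)(\<xi> := Q)) ((bs h i)(\<xi> := ?c i Q)) \<xi>"
    "follows (\<sigma> i) ((ps h i)(\<xi> := Q)) ((bs h i)(\<xi> := ?c i Q)) \<xi>"
    "?c i Q \<in> Q" "?c i Q \<in> positive_sets (al i) (F i)"
    if "i \<in> E" "partition_on (?X i) Q" "|Q| <o |{..<al i}|" for i Q
    using answer_legal[OF win[OF that(1)] \<xi> positive[OF that(1), folded W_def] legal[OF that(1)] that(2,3)]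
    by auto
  note \<Gamma> = below_subset[OF less_imp_le[OF \<xi>] hist]
  have R: "\<beta> < al j" if "nstar < j" "\<beta> \<in> ?R j" for j \<beta>
    using that al_less[of 0 j] by (auto split: if_splits)
  obtain P where P: "\<And>i. i \<in> ?e \<Longrightarrow> partition_on (?X i) (P i)" "\<And>i. i \<in> ?e \<Longrightarrow> |P i| <o |{..<al i}|"
    and stab: "\<And>j \<beta> d d'. nstar < j \<Longrightarrow> \<beta> \<in> ?R j \<Longrightarrow>
      (\<And>i. i \<in> ?e \<Longrightarrow> d i \<in> ?c i (P i) \<and> d' i \<in> ?c i (P i)) \<Longrightarrow> V ?\<Gamma> ?e j \<beta> d = V ?\<Gamma> ?e j \<beta> d'"
    and clos: "\<And>j \<beta> d. j \<in> ?e \<Longrightarrow> (\<And>i. i \<in> ?e \<Longrightarrow> d i \<in> ?c i (P i)) \<Longrightarrow> \<beta> < d j \<Longrightarrow> V ?\<Gamma> ?e j \<beta> d \<le> d j"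
  proof (rule stabilise[OF gch E, of ?e ?X F ?c "V ?\<Gamma> ?e" ?R])
    show "0 < nstar" using m by simp
    show "finite ?e" "?e \<subseteq> E" by (auto simp: active_def)
    show "?X i \<subseteq> {..<al i}" if "i \<in> ?e" for i
      using WX[of i] that by (auto simp: active_def W_def)
    show "in_filter C (F i)" if "i \<in> ?e" "club_in (al i) C" for i C
      using clubs that by (auto simp: active_def)
    show "?c i P \<in> P \<and> ?c i P \<in> positive_sets (al i) (F i)"
      if "i \<in> ?e" "partition_on (?X i) P" "|P| <o |{..<al i}|" for i P
      using ans(3,4) that by (auto simp: active_def)
    show "V ?\<Gamma> ?e j \<beta> d = V ?\<Gamma> ?e j \<beta> d'" if "\<And>i. i \<in> ?e \<Longrightarrow> j < i \<Longrightarrow> d i = d' i" for j \<beta> d d'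
    proof -
      have "gens ?\<Gamma> ?e j \<beta> d = gens ?\<Gamma> ?e j \<beta> d'" unfolding gens_def using that by auto
      then show ?thesis unfolding V_def by simp
    qed
    show "V ?\<Gamma> ?e j \<beta> d < al j" if "nstar < j" "\<beta> \<in> ?R j" for j \<beta> d
      using V_bound(1)[OF that(1) R[OF that] \<Gamma>] .
  qed (rule refl, use that in blast)
  \<comment> \<open>Inactive games receive the one-part partition; removing the empty set keeps it a
    partition even for an empty position.\<close>
  define P' where "P' i = (if i \<in> ?e then P i else {?X i} - {{}})" for i
  have P': "partition_on (?X i) (P' i)" "|P' i| <o |{..<al i}|" if "i \<in> E" for i
  proof -
    have "partition_on (?X i) ({?X i} - {{}})" by (auto simp: partition_on_def disjoint_def)
    then show "partition_on (?X i) (P' i)" using P(1) by (simp add: P'_def)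
    have "|{?X i} - {{}}| <o |{..<al i}|"
      by (intro finite_ordLess_infinite card_of_Well_order) (auto simp: Field_card_of infinite_al)
    then show "|P' i| <o |{..<al i}|" using P(2) by (simp add: P'_def)
  qed
  define b where "b i = ?c i (P' i)" for i
  have be: "b i = ?c i (P i)" if "i \<in> ?e" for i using that by (simp add: b_def P'_def)
  have bP: "b i \<in> P' i" if "i \<in> E" for i using ans(3)[OF that P'[OF that]] by (simp add: b_def)
  have bW: "b i \<subseteq> W i" if "i \<in> E" for i
    using bP[OF that] P'(1)[OF that] WX[OF that] unfolding partition_on_def by blast
  have "\<exists>x. x \<in> b i" if "i \<in> E" for i
    using bP[OF that] P'(1)[OF that] unfolding partition_on_def by (metis ex_in_conv)
  then obtain d0 where d0: "\<And>i. i \<in> E \<Longrightarrow> d0 i \<in> b i" by metis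
  \<comment> \<open>The points \<open>d0\<close> merely name the value: \<open>stab\<close> makes it
    common to all choices from the replies.\<close>
  define \<gamma> where "\<gamma> j = V ?\<Gamma> ?e j (al 0) d0" for j
  let ?h = "h(\<xi> := (P', b, \<gamma>))"
  have h: "ps ?h i = (ps h i)(\<xi> := P' i)" "bs ?h i = (bs h i)(\<xi> := b i)" "gs ?h i = (gs h i)(\<xi> := \<gamma> i)" for i
    by (auto simp: ps_def bs_def gs_def fun_eq_iff)
  have below: "below ?h \<xi> = ?\<Gamma>" by (auto simp: below_def h)
  have "good \<xi> ?h"
    unfolding good_def below
  proof (intro conjI ballI allI impI)
    fix i assume "i \<in> E"
    then show "first_legal (al i) (F i) (ps ?h i) (bs ?h i) \<xi>" "follows (\<sigma> i) (ps ?h i) (bs ?h i) \<xi>"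
      using ans(1,2) P' unfolding h b_def by blast+
    show "bs ?h i \<xi> \<subseteq> W i" using bW \<open>i \<in> E\<close> by (simp add: h)
  next
    fix j d assume j: "nstar < j" "j \<notin> E"
    show "gs ?h j \<xi> < al j" using V_bound(1)[OF j(1) R \<Gamma>] j by (simp add: h \<gamma>_def)
    assume "\<forall>i\<in>?e. d i \<in> bs ?h i \<xi>"
    then have "d i \<in> ?c i (P i) \<and> d0 i \<in> ?c i (P i)" if "i \<in> ?e" for i
    proof -
      have "d i \<in> b i" using \<open>\<forall>i\<in>?e. d i \<in> bs ?h i \<xi>\<close> that by (simp add: h)
      moreover have "d0 i \<in> b i" using d0 that by (simp add: active_def)
      ultimately show ?thesis using be[OF that] by simp
    qed
    then show "V ?\<Gamma> ?e j (al 0) d = gs ?h j \<xi>"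
      using stab[of j "al 0" d d0] j by (simp add: h \<gamma>_def)
  next
    fix j d \<beta> assume "j \<in> ?e" "\<forall>i\<in>?e. d i \<in> bs ?h i \<xi>" "\<beta> < d j"
    then show "V ?\<Gamma> ?e j \<beta> d \<le> d j" using clos[of j d \<beta>] be by (simp add: h)
  qed
  then show ?thesis ..
qed

lemma exists_good_play: "\<exists>h. \<forall>\<xi><al m. good \<xi> h"
proof -
  \<comment> \<open>The candidate play is constantly \<open>r\<close> from \<xi> on; by
    \<open>good_cong\<close> this only tests \<open>r\<close> as move \<xi> after the history
    \<open>f\<close>.\<close>
  define Q where "Q f \<xi> r \<longleftrightarrow> \<xi> < al m \<longrightarrow> good \<xi> (\<lambda>\<eta>. if \<eta> < \<xi> then f \<eta> else r)" for f \<xi> r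
  have "\<exists>f. \<forall>\<xi>. Q f \<xi> (f \<xi>)"
  proof (rule dependent_wf_choice[OF wf])
    show "Q f \<xi> r = Q f' \<xi> r" if "\<And>\<eta>. (\<eta>, \<xi>) \<in> {(x, y). x < y} \<Longrightarrow> f \<eta> = f' \<eta>" for f f' \<xi> r
    proof -
      have "(\<lambda>\<eta>. if \<eta> < \<xi> then f \<eta> else r) = (\<lambda>\<eta>. if \<eta> < \<xi> then f' \<eta> else r)"
        using that by auto
      then show ?thesis by (simp add: Q_def)
    qed
  next
    fix \<xi> f assume IH: "\<And>\<eta>. (\<eta>, \<xi>) \<in> {(x, y). x < y} \<Longrightarrow> Q f \<eta> (f \<eta>)"
    show "\<exists>r. Q f \<xi> r"
    proof (cases "\<xi> < al m")
      case True
      have "good \<eta> f" if "\<eta> < \<xi>" for \<eta>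
      proof -
        have "good \<eta> (\<lambda>\<zeta>. if \<zeta> < \<eta> then f \<zeta> else f \<eta>)" using IH[of \<eta>] that True unfolding Q_def by auto
        then show ?thesis by (subst good_cong) auto
      qed
      then obtain r where "good \<xi> (f(\<xi> := r))" using exists_good_extension[OF True] by blast
      then have "good \<xi> (\<lambda>\<eta>. if \<eta> < \<xi> then f \<eta> else r)"
        by (subst good_cong[of _ _ "f(\<xi> := r)"]) auto
      then show ?thesis unfolding Q_def by blast
    qed (simp add: Q_def)
  qed
  then obtain f where f: "\<And>\<xi>. Q f \<xi> (f \<xi>)" by blast
  have "good \<xi> f" if "\<xi> < al m" for \<xi>
    using f[of \<xi>] that unfolding Q_def by (subst good_cong[of _ _ "\<lambda>\<eta>. if \<eta> < \<xi> then f \<eta> else f \<xi>"]) auto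
  then show ?thesis by blast
qed

section \<open>Cofinalities of the final hull\<close>

lemma cf_bounded:
  assumes "cf {..<\<delta>} = al k" "|s| <o |{..<al k}|" "s \<subseteq> {..<\<delta>}"
  shows "\<exists>\<beta><\<delta>. s \<subseteq> {..<\<beta>}"
proof (rule ccontr)
  assume neg: "\<not> ?thesis"
  obtain \<nu> where \<nu>: "\<nu> < al k" "|s| =o |{..<\<nu>}|"
    using card_of_ordLess_lessThan[OF assms(2)] by metis
  have "\<exists>a\<in>s. x \<le> a" if "x < \<delta>" for x
    using neg that by (metis lessThan_iff not_le_imp_less subsetI)
  then have "cf {..<\<delta>} \<le> \<nu>"
    using assms(3) \<nu>(2) by (intro cf_le[of s]) (auto simp: ordIso_imp_ordLeq)
  then show False using assms(1) \<nu>(1) by simp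
qed

text \<open>Each element of the final hull has finite support among the generators, all present at
  one move. The supremum fixed at that move then bounds it, by the next term of the sequence or by
  \<open>\<delta> j\<close>.\<close>

lemma exists_hull_with_cofinalities:
  obtains N where "N \<subseteq> {..<aleph_omega}" "|N| \<le>o |{..<al nstar}|" "\<exists>X. N = hull g X"
    "\<And>j. nstar < j \<Longrightarrow> cf (N \<inter> {..<al j}) = (if j \<in> E then al (n j) else al m)"
proof -
  obtain h where h: "\<And>\<xi>. \<xi> < al m \<Longrightarrow> good \<xi> h" using exists_good_play by blast
  have legal: "first_legal (al i) (F i) (ps h i) (bs h i) \<xi> \<and> follows (\<sigma> i) (ps h i) (bs h i) \<xi>"
    and bW: "bs h i \<xi> \<subseteq> W i" if "i \<in> E" "\<xi> < al m" for i \<xi>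
    using h[OF that(2)] that(1) unfolding good_def by blast+
  have al0: "\<exists>\<xi>. \<xi> < al m" using infinite_al[of m] by (metis finite.emptyI lessThan_iff subsetI subset_empty)
  \<comment> \<open>Winning makes the intersection of all replies unbounded; a member above
    \<open>al 0\<close> is enough.\<close>
  have "\<exists>\<delta>. \<delta> < al i \<and> (\<forall>\<xi><al m. \<delta> \<in> bs h i \<xi>)" if "i \<in> E" for i
  proof -
    have "unbounded_in (al i) (\<Inter>\<xi>\<in>{..<al m}. bs h i \<xi>)"
      using win[OF that] legal[OF that] unfolding winning_strategy_def by blast
    moreover have "al 0 < al i" using that E(1) al_less[of 0 i] by auto
    ultimately show ?thesis unfolding unbounded_in_def by blast
  qed
  then obtain \<delta> where \<delta>: "\<And>i. i \<in> E \<Longrightarrow> \<delta> i < al i" "\<And>i \<xi>. i \<in> E \<Longrightarrow> \<xi> < al m \<Longrightarrow> \<delta> i \<in> bs h i \<xi>"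
    by metis
  have cf\<delta>: "cf {..<\<delta> i} = al (n i)" if "i \<in> E" for i
    using \<delta>(2)[OF that] bW[OF that] al0 unfolding W_def by blast
  have c\<delta>: "cofs (\<delta> i) \<subseteq> {..<\<delta> i}" "\<forall>x<\<delta> i. \<exists>a\<in>cofs (\<delta> i). x \<le> a" if "i \<in> E" for i
    using cofs(3)[of "\<delta> i"] cf\<delta>[OF that] n that \<delta>(1)[OF that] al_less_aleph_omega[of i]
    by (meson less_trans)+
  let ?\<Gamma> = "below h (al m)"
  let ?G = "{..<al nstar} \<union> ?\<Gamma> \<union> (\<Union>i\<in>E. cofs (\<delta> i))"
  let ?N = "hull g ?G"
  have h': "good \<eta> h" if "\<xi> < al m" "\<eta> < \<xi>" for \<xi> \<eta> using h that by simp
  note \<Gamma> = below_subset[OF order_refl h]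
  have \<Gamma>\<xi>: "below h \<xi> \<subseteq> {..<aleph_omega}" "|below h \<xi>| \<le>o |{..<al nstar}|" if "\<xi> < al m" for \<xi>
    using below_subset[OF less_imp_le[OF that] h'[OF that]] by auto
  have "|?G| \<le>o |{..<al nstar}|"
    by (intro card_of_Un_le card_of_UN_le infinite_al card_of_nat_le \<Gamma>(2) cofs(2) card_of_mono1[OF subset_refl])
  moreover have "?G \<subseteq> {..<aleph_omega}"
    using \<Gamma>(1) cofs(1) al_less_aleph_omega[of nstar] by fastforce
  ultimately have N: "|?N| \<le>o |{..<al nstar}|" "?N \<subseteq> {..<aleph_omega}"
    using card_hull_le[OF infinite_al, of ?G nstar "{..<aleph_omega}" g] g by blast+
  have active: "\<forall>i\<in>active \<xi>. \<delta> i \<in> bs h i \<xi>" if "\<xi> < al m" for \<xi>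
    using \<delta>(2) that by (auto simp: active_def)
  \<comment> \<open>A generator persists at all late moves of large level, as \<open>below\<close>
    grows and \<open>active\<close> contains every index of \<open>E\<close> up to the level. For
    finitely many generators the thresholds have a maximum, and \<open>level\<close> meets it
    late.\<close>
  have approx: "\<exists>\<xi><al m. k \<le> level \<xi> \<and>
      s \<subseteq> {..<al nstar} \<union> below h \<xi> \<union> (\<Union>i\<in>active \<xi>. cofs (\<delta> i))" if "finite s" "s \<subseteq> ?G" for s k
  proof -
    have "\<exists>K \<xi>0. \<xi>0 < al m \<and> (\<forall>\<xi>. \<xi>0 \<le> \<xi> \<longrightarrow> \<xi> < al m \<longrightarrow> K \<le> level \<xi> \<longrightarrow>
        s \<subseteq> {..<al nstar} \<union> below h \<xi> \<union> (\<Union>i\<in>active \<xi>. cofs (\<delta> i)))"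
      using that
    proof (induction s rule: finite_induct)
      case empty
      then show ?case using al0 by blast
    next
      case (insert y s)
      then obtain K \<xi>0 where 1: "\<xi>0 < al m"
        "\<And>\<xi>. \<xi>0 \<le> \<xi> \<Longrightarrow> \<xi> < al m \<Longrightarrow> K \<le> level \<xi> \<Longrightarrow>
          s \<subseteq> {..<al nstar} \<union> below h \<xi> \<union> (\<Union>i\<in>active \<xi>. cofs (\<delta> i))" by auto
      consider "y < al nstar" | "y \<in> ?\<Gamma>" | i where "i \<in> E" "y \<in> cofs (\<delta> i)"
        using insert.prems by auto
      then have "\<exists>L \<xi>1. \<xi>1 < al m \<and> (\<forall>\<xi>. \<xi>1 \<le> \<xi> \<longrightarrow> \<xi> < al m \<longrightarrow> L \<le> level \<xi> \<longrightarrow>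
          y \<in> {..<al nstar} \<union> below h \<xi> \<union> (\<Union>i\<in>active \<xi>. cofs (\<delta> i)))"
      proof cases
        case 1
        then show ?thesis using al0 by blast
      next
        case 2
        then obtain j \<eta> where y: "nstar < j" "j \<notin> E" "\<eta> < al m" "y = gs h j \<eta>"
          unfolding below_def by auto
        have "|{\<eta>}| <o |{..<al m}|"
          by (intro finite_ordLess_infinite card_of_Well_order) (auto simp: Field_card_of infinite_al)
        then obtain \<xi>1 where "\<xi>1 < al m" "\<eta> < \<xi>1"
          using bounded_below_al[of "{\<eta>}" m] y(3) by auto
        moreover have "y \<in> below h \<xi>" if "\<xi>1 \<le> \<xi>" for \<xi>
          unfolding below_def using y that \<open>\<eta> < \<xi>1\<close> by auto
        ultimately show ?thesis by blast
      next
        case 3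
        obtain \<xi>1 where "\<xi>1 < al m" using al0 ..
        moreover have "y \<in> (\<Union>i\<in>active \<xi>. cofs (\<delta> i))" if "i \<le> level \<xi>" for \<xi>
          using that 3 unfolding active_def by blast
        ultimately show ?thesis by blast
      qed
      then obtain L \<xi>1 where 2: "\<xi>1 < al m"
        "\<And>\<xi>. \<xi>1 \<le> \<xi> \<Longrightarrow> \<xi> < al m \<Longrightarrow> L \<le> level \<xi> \<Longrightarrow>
          y \<in> {..<al nstar} \<union> below h \<xi> \<union> (\<Union>i\<in>active \<xi>. cofs (\<delta> i))" by blast
      show ?case
        by (rule exI[of _ "max K L"], rule exI[of _ "max \<xi>0 \<xi>1"])
          (use 1(1) 2(1) 1(2) 2(2) in \<open>simp only: max_less_iff_conj max.bounded_iff insert_subset; blast\<close>)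
    qed
    then obtain K \<xi>0 where 1: "\<xi>0 < al m"
        "\<And>\<xi>. \<xi>0 \<le> \<xi> \<Longrightarrow> \<xi> < al m \<Longrightarrow> K \<le> level \<xi> \<Longrightarrow>
          s \<subseteq> {..<al nstar} \<union> below h \<xi> \<union> (\<Union>i\<in>active \<xi>. cofs (\<delta> i))" by blast
    obtain \<xi> where "\<xi>0 \<le> \<xi>" "\<xi> < al m" "level \<xi> = max k K" using level[OF 1(1)] by blast
    then show ?thesis using 1(2)[of \<xi>] by (intro exI[of _ \<xi>]) auto
  qed
  have low: "cofs (\<delta> i) \<subseteq> {..<al (j - 1)}" if "i \<in> E" "i < j" for i j
    using c\<delta>(1)[OF that(1)] \<delta>(1)[OF that(1)] al_le[of i "j - 1"] that(2) by fastforce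
  have nstar_low: "al nstar \<le> al (j - 1)" if "nstar < j" for j
    using that by (intro al_le) auto
  have cN: "|?N \<inter> {..<al j}| \<le>o |{..<al nstar}|" for j
    by (rule card_of_subset_le[OF Int_lower1 N(1)])
  have cf_other: "cf (?N \<inter> {..<al j}) = al m" if j: "nstar < j" "j \<notin> E" for j
  proof -
    have R: "al 0 < al j" using al_less[of 0 j] j(1) by simp
    have gV: "V (below h \<xi>) (active \<xi>) j (al 0) \<delta> = gs h j \<xi>" and gj: "gs h j \<xi> < al j" if "\<xi> < al m" for \<xi>
      using h[OF that] active[OF that] j unfolding good_def by blast+
    have "cf (gs h j ` {..<al m}) = al m"
    proof (rule cf_strict_mono_image[OF regular_al al_initial])
      \<comment> \<open>The earlier term is a generator at move \<xi>, strictly below the supremum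
        recorded there.\<close>
      fix \<xi> \<eta> assume *: "\<eta> < \<xi>" "\<xi> < al m"
      have "gs h j \<eta> \<in> below h \<xi>" unfolding below_def using j * by blast
      then have "gs h j \<eta> \<in> gens (below h \<xi>) (active \<xi>) j (al 0) \<delta>" by (simp add: gens_def)
      then have "gs h j \<eta> \<in> hull g (gens (below h \<xi>) (active \<xi>) j (al 0) \<delta>)"
        by (rule subsetD[OF subset_hull])
      then have "gs h j \<eta> < V (below h \<xi>) (active \<xi>) j (al 0) \<delta>"
        using V_bound(2)[OF j(1) R \<Gamma>\<xi>[OF *(2)]] gj[of \<eta>] * by simp
      then show "gs h j \<eta> < gs h j \<xi>" using gV *(2) by simp
    qed
    moreover have "cf (?N \<inter> {..<al j}) = cf (gs h j ` {..<al m})"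
    proof (rule cf_cofinal_subset[OF _ _ cN])
      have "gs h j ` {..<al m} \<subseteq> ?\<Gamma>" unfolding below_def using j by blast
      then show "gs h j ` {..<al m} \<subseteq> ?N \<inter> {..<al j}" using subset_hull[of ?G g] gj by auto
      show "\<forall>x\<in>?N \<inter> {..<al j}. \<exists>y\<in>gs h j ` {..<al m}. x \<le> y"
      proof
        fix x assume x: "x \<in> ?N \<inter> {..<al j}"
        then obtain s where s: "finite s" "s \<subseteq> ?G" "x \<in> hull g s" using hull_finitary[of x g ?G] by auto
        obtain \<xi> where \<xi>: "\<xi> < al m"
          "s \<subseteq> {..<al nstar} \<union> below h \<xi> \<union> (\<Union>i\<in>active \<xi>. cofs (\<delta> i))"
          using approx[OF s(1,2)] by blast
        \<comment> \<open>The case \<open>i = j\<close> cannot occur as \<open>j \<notin> E\<close>;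
          for \<open>i < j\<close> the segment \<open>{..<al (j - 1)}\<close> absorbs the
          set.\<close>
        have "cofs (\<delta> i) \<subseteq> gens (below h \<xi>) (active \<xi>) j (al 0) \<delta>" if "i \<in> active \<xi>" for i
        proof (cases "j < i")
          case False
          then have "i < j" "i \<in> E" using that j(2) by (auto simp: active_def le_less not_less)
          then show ?thesis using low unfolding gens_def by blast
        qed (use that in \<open>auto simp: gens_def\<close>)
        moreover have "{..<al nstar} \<union> below h \<xi> \<subseteq> gens (below h \<xi>) (active \<xi>) j (al 0) \<delta>"
          using nstar_low[OF j(1)] unfolding gens_def by auto
        ultimately have "s \<subseteq> gens (below h \<xi>) (active \<xi>) j (al 0) \<delta>" using \<xi>(2) by blast
        then have "x \<in> hull g (gens (below h \<xi>) (active \<xi>) j (al 0) \<delta>)"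
          by (rule subsetD[OF hull_mono s(3)])
        then have "x < V (below h \<xi>) (active \<xi>) j (al 0) \<delta>"
          using V_bound(2)[OF j(1) R \<Gamma>\<xi>[OF \<xi>(1)]] x by blast
        then have "x < gs h j \<xi>" using gV[OF \<xi>(1)] by simp
        then show "\<exists>y\<in>gs h j ` {..<al m}. x \<le> y" using \<xi>(1) by (intro bexI[of _ "gs h j \<xi>"]) auto
      qed
    qed
    ultimately show ?thesis by simp
  qed
  have cf_E: "cf (?N \<inter> {..<al j}) = al (n j)" if j: "j \<in> E" for j
  proof -
    have nj: "nstar < j" using j E by blast
    have sub: "cofs (\<delta> j) \<subseteq> ?N \<inter> {..<al j}"
    proof -
      have "cofs (\<delta> j) \<subseteq> ?G" using j by blast
      then have "cofs (\<delta> j) \<subseteq> ?N" using subset_hull by (rule subset_trans)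
      moreover have "cofs (\<delta> j) \<subseteq> {..<al j}" using c\<delta>(1)[OF j] \<delta>(1)[OF j] by auto
      ultimately show ?thesis by blast
    qed
    have below_\<delta>: "x < \<delta> j" if x: "x \<in> ?N" "x < al j" for x
    proof -
      obtain s where s: "finite s" "s \<subseteq> ?G" "x \<in> hull g s" using hull_finitary[OF x(1)] by metis
      \<comment> \<open>The demand on the level makes \<open>j\<close> active, so the closure clause
        of \<open>good\<close> applies to \<open>\<delta> j\<close>.\<close>
      obtain \<xi> where \<xi>: "\<xi> < al m" "j \<le> level \<xi>"
        "s \<subseteq> {..<al nstar} \<union> below h \<xi> \<union> (\<Union>i\<in>active \<xi>. cofs (\<delta> i))"
        using approx[OF s(1,2)] by blast
      \<comment> \<open>A finite set is bounded in \<open>\<delta> j\<close>, whose cofinality is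
        infinite. The segment below such a bound \<beta> stands in for
        \<open>cofs (\<delta> j)\<close>, which \<open>gens\<close> omits at
        \<open>j\<close>.\<close>
      have "|s \<inter> cofs (\<delta> j)| <o |{..<al (n j)}|"
        using s(1) by (intro finite_ordLess_infinite card_of_Well_order) (auto simp: Field_card_of infinite_al)
      then obtain \<beta> where \<beta>: "\<beta> < \<delta> j" "s \<inter> cofs (\<delta> j) \<subseteq> {..<\<beta>}"
        using cf_bounded[OF cf\<delta>[OF j], of "s \<inter> cofs (\<delta> j)"] c\<delta>(1)[OF j] by blast
      let ?gen = "gens (below h \<xi>) (active \<xi>) j \<beta> \<delta>"
      have "s \<inter> cofs (\<delta> i) \<subseteq> ?gen" if i: "i \<in> active \<xi>" for i
      proof -
        consider "j < i" | "i = j" | "i < j" "i \<in> E" using i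
          by (cases i j rule: linorder_cases) (auto simp: active_def)
        then show ?thesis
        proof cases
          case 3
          then show ?thesis using low[of i j] unfolding gens_def by blast
        qed (use i \<beta>(2) in \<open>auto simp: gens_def\<close>)
      qed
      moreover have "{..<al nstar} \<union> below h \<xi> \<subseteq> ?gen"
        using nstar_low[OF nj] unfolding gens_def by auto
      ultimately have "s \<subseteq> ?gen" using \<xi>(3) by blast
      then have "x \<in> hull g ?gen" by (rule subsetD[OF hull_mono s(3)])
      moreover have "\<beta> < al j" using \<beta>(1) \<delta>(1)[OF j] by simp
      ultimately have "x < V (below h \<xi>) (active \<xi>) j \<beta> \<delta>"
        using V_bound(2)[OF nj _ \<Gamma>\<xi>[OF \<xi>(1)]] x(2) by metis
      also have "\<dots> \<le> \<delta> j"
        using h[OF \<xi>(1)] active[OF \<xi>(1)] \<beta>(1) j \<xi>(2) unfolding good_def by (simp add: active_def)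
      finally show ?thesis .
    qed
    \<comment> \<open>\<open>cofs (\<delta> j)\<close> is cofinal both in the trace of the hull,
      which lies below \<open>\<delta> j\<close>, and in \<open>\<delta> j\<close> itself.\<close>
    have "cf (?N \<inter> {..<al j}) = cf (cofs (\<delta> j))"
      by (rule cf_cofinal_subset[OF sub _ cN]) (use below_\<delta> c\<delta>(2)[OF j] in blast)
    also have "\<dots> = cf {..<\<delta> j}"
      by (rule cf_cofinal_subset[symmetric, OF c\<delta>(1)[OF j] _ card_of_mono1[OF subset_refl]])
        (use c\<delta>(2)[OF j] in auto)
    finally show ?thesis using cf\<delta>[OF j] by simp
  qed
  show ?thesis
    by (rule that[of ?N]) (use N cf_other cf_E in auto)
qed

end

section \<open>Stationarity from closed hulls\<close>

theorem theorem4p2: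
  fixes m nstar :: nat and E :: "nat set" and n f :: "nat \<Rightarrow> nat"
  assumes "has_aleph_omega TYPE('a::wellorder)"
    and "gch TYPE('a)"
    and "m < nstar"
    and "E \<subseteq> {i. nstar < i}"
    and "\<forall>i\<in>E. i + 1 \<notin> E"
    and "\<forall>i\<in>E. n i < nstar"
    and "\<forall>i\<in>E. \<exists>F :: 'a filter.
           filter_on (aleph i) F \<and> complete_filter (aleph i) F \<and>
           (\<forall>C. club_in (aleph i) C \<longrightarrow> in_filter C F) \<and>
           {\<alpha>. \<alpha> < aleph i \<and> cf {..<\<alpha>} = aleph (n i)} \<in> positive_sets (aleph i) F \<and>
           second_wins_GM' (aleph m) (aleph i) F"
    and "\<forall>i. nstar < i \<longrightarrow> f i = (if i \<in> E then n i else m)"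
  shows "stationary_in_subsets {..<aleph_omega :: 'a} (aleph (nstar + 1))
           {x. x \<subseteq> {..<aleph_omega} \<and> |x| \<le>o |{..<aleph nstar :: 'a}| \<and>
               (\<forall>i. nstar < i \<longrightarrow> cf (x \<inter> {..<aleph i}) = aleph (f i))}"
proof -
  let ?A = "{..<aleph_omega :: 'a}" and ?\<mu> = "aleph (nstar + 1) :: 'a"
  let ?S = "{x. x \<subseteq> {..<aleph_omega} \<and> |x| \<le>o |{..<aleph nstar :: 'a}| \<and>
    (\<forall>i. nstar < i \<longrightarrow> cf (x \<inter> {..<aleph i}) = aleph (f i))}"
  interpret aleph_universe "TYPE('a)" by unfold_locales (rule assms(1))
  have below: "x \<in> subsets_below ?A ?\<mu> \<longleftrightarrow> x \<subseteq> ?A \<and> |x| \<le>o |{..<al nstar}|" for x :: "'a set"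
    unfolding subsets_below_def by (simp add: card_less_al_Suc)
  obtain F \<sigma> where F: "\<And>i C. i \<in> E \<Longrightarrow> club_in (al i) C \<Longrightarrow> in_filter C (F i)"
      "\<And>i. i \<in> E \<Longrightarrow> {\<alpha>. \<alpha> < al i \<and> cf {..<\<alpha>} = al (n i)} \<in> positive_sets (al i) (F i)"
      "\<And>i. i \<in> E \<Longrightarrow> winning_strategy (al m) (al i) (F i) (\<sigma> i)"
    using assms(7) unfolding second_wins_GM'_def by metis
  obtain level :: "'a \<Rightarrow> nat" where
    level: "\<And>k \<xi>. \<xi> < al m \<Longrightarrow> \<exists>\<xi>'. \<xi> \<le> \<xi>' \<and> \<xi>' < al m \<and> level \<xi>' = k"
    using cofinal_fibres[OF infinite_al al_initial] by metis
  \<comment> \<open>Cofinality below \<open>al nstar\<close> leaves room for a cofinal subset; all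
    other ordinals receive the empty set as a default.\<close>
  have "\<exists>c. c \<subseteq> {..<aleph_omega} \<and> |c| \<le>o |{..<al nstar}| \<and>
      (\<delta> < aleph_omega \<longrightarrow> (\<exists>k<nstar. cf {..<\<delta>} = al k) \<longrightarrow>
        c \<subseteq> {..<\<delta>} \<and> (\<forall>x<\<delta>. \<exists>a\<in>c. x \<le> a))" for \<delta> :: 'a
  proof (cases "\<delta> < aleph_omega \<and> (\<exists>k<nstar. cf {..<\<delta>} = al k)")
    case True
    then obtain k where k: "k < nstar" "cf {..<\<delta>} = al k" by blast
    obtain c where c: "c \<subseteq> {..<\<delta>}" "\<forall>x\<in>{..<\<delta>}. \<exists>a\<in>c. x \<le> a" "|c| =o |{..<cf {..<\<delta>}}|"
      using cf_witness[OF card_of_mono1[OF subset_refl]] by metis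
    moreover have "|c| \<le>o |{..<al nstar}|"
      using c(3) card_al_le[of k nstar] k ordIso_ordLeq_trans by auto
    ultimately show ?thesis using True by (intro exI[of _ c]) auto
  qed (auto intro!: exI[of _ "{}"] simp: card_of_empty)
  then obtain cofs :: "'a \<Rightarrow> 'a set" where cofs: "\<And>\<delta>. cofs \<delta> \<subseteq> {..<aleph_omega}"
    "\<And>\<delta>. |cofs \<delta>| \<le>o |{..<al nstar}|"
    "\<And>\<delta>. \<delta> < aleph_omega \<Longrightarrow> \<exists>k<nstar. cf {..<\<delta>} = al k \<Longrightarrow>
       cofs \<delta> \<subseteq> {..<\<delta>} \<and> (\<forall>x<\<delta>. \<exists>a\<in>cofs \<delta>. x \<le> a)"
    by metis
  have "?S \<inter> C \<noteq> {}" if C: "club_in_subsets ?A ?\<mu> C" for C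
  proof -
    obtain g where gC: "\<And>s. finite s \<Longrightarrow> s \<subseteq> ?A \<Longrightarrow> g s \<in> C"
      "\<And>s. finite s \<Longrightarrow> s \<subseteq> ?A \<Longrightarrow> s \<subseteq> g s"
      "\<And>s t. finite t \<Longrightarrow> t \<subseteq> ?A \<Longrightarrow> s \<subseteq> t \<Longrightarrow> g s \<subseteq> g t"
      using club_closure_function[OF C infinite_al] by metis
    have "C \<subseteq> subsets_below ?A ?\<mu>" using C unfolding club_in_subsets_def by blast
    then have g_small: "g s \<subseteq> ?A \<and> |g s| \<le>o |{..<al nstar}|" if "finite s" "s \<subseteq> ?A" for s
      using gC(1)[OF that] below by blast
    interpret cofinality_games "TYPE('a)" m nstar E n F \<sigma> g cofs level
      by unfold_locales (fact assms(2-6) F g_small cofs level)+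
    obtain N X where N: "N \<subseteq> ?A" "|N| \<le>o |{..<al nstar}|" "N = hull g X"
      "\<And>j. nstar < j \<Longrightarrow> cf (N \<inter> {..<al j}) = (if j \<in> E then al (n j) else al m)"
      using exists_hull_with_cofinalities by metis
    \<comment> \<open>One more step applied to \<open>N\<close> lands in the club and leaves
      \<open>N\<close> unchanged, so \<open>N\<close> itself belongs to \<open>C\<close>.\<close>
    have "hull_step g N \<in> C"
      using hull_step_in_club[OF C gC(1,3), where Y = N] N(1,2) by (simp add: card_less_al_Suc)
    moreover have "hull_step g N = N"
      unfolding N(3) by (rule hull_step_hull[OF gC(2)]) (use N in auto)
    moreover have "N \<in> ?S" using N assms(8) by auto
    ultimately show ?thesis by auto
  qed
  moreover have "?S \<subseteq> subsets_below ?A ?\<mu>" using below by blast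
  ultimately show ?thesis unfolding stationary_in_subsets_def by blast
qed

end
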